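(* Let $G$ be a threshold graph on $\{0,1,\dots,n\}$, labeled by reverse degree sequence, with edges directed from $i$ to $j$ when $i>j$, and let $\mathbf a=(a_1,\dots,a_n)\in\mathbb Z_{>0}^n$. (a) Let $\widetilde G$ be the multigraph obtained from $G$ by replacing each edge $(i,j)$ by $a_{\max\{i,j\}}$ parallel edges. If $G$ is connected, then $\operatorname{Ehr}_{q,1}(\mathcal F_G(\mathbf a))=t_{\widetilde G}(1,q)$. (b) For any spanning tree $T$ of $G$, let \[w(T)=\prod_{(i,j)\in E(T)}[a_{\max\{i,j\}}]_q\cdot\prod_{(i,j)\in\operatorname{Inv}(T)} q^{a_{\max\{p_T(i),j\}}}.\] Then $\operatorname{Ehr}_{q,1}(\mathcal F_G(\mathbf a))=\sum_T w(T)$, where $T$ ranges over all spanning trees of $G$.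
   Context: A threshold graph is built from one vertex by repeatedly adding a dominating vertex or an isolated vertex; labeled by reverse degree sequence means vertices $0,\dots,n$ with $d_i\ge d_j$ for $i<j$. $\mathcal F_G(\mathbf a)$ is the set of $x\in\mathbb R_{\ge0}^E$ such that for each vertex $k\ge1$ the flow out of $k$ (on edges to smaller vertices) minus the flow into $k$ equals $a_k$, and the net flow at $0$ is $-\sum a_i$. $wt_{q,t}(b)=\frac{q^b-t^b}{q-t}$ for $b>0$, $wt_{q,t}(0)=1$; for an integer flow $A=(a_{ij})$, $wt_{q,t}(A)=(-(1-t)(1-q))^{\#\{a_{ij}>0\}-n}\prod wt_{q,t}(a_{ij})$; $\operatorname{Ehr}_{q,t}(\mathcal F_G(\mathbf a))=\sum_{A\in\mathcal F_G(\mathbf a)\cap\mathbb Z^E}wt_{q,t}(A)$. The Tutte polynomial of a multigraph $H=(V,E)$ is $t_H(x,y)=\sum_{A\subseteq E}(x-1)^{k(A)-k(E)}(y-1)^{k(A)+|A|-|V|}$. Spanning trees are rooted at $0$; $E(T)$ is the edge set, $p_T(i)$ the parent of $i$ (its neighbor on the tree path from $0$ to $i$); $v$ is a descendant of $u$ if $u$ lies on the tree path from $0$ to $v$. $\operatorname{Inv}(T)$ is the set of inversions: pairs $(i,j)$ with $i\neq0$, $i>j$, $j$ a descendant of $i$. $[k]_q=1+q+\dots+q^{k-1}$. *)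

theory Defs
  imports Complex_Main "HOL-Library.FuncSet" "HOL-Computational_Algebra.Polynomial"
begin

text \<open>A simple graph is a vertex set together with a set of two-element vertex sets.\<close>

inductive threshold_graph :: "'v set \<Rightarrow> 'v set set \<Rightarrow> bool" where
  single: "threshold_graph {v} {}"
| isolated: "threshold_graph V E \<Longrightarrow> v \<notin> V \<Longrightarrow> threshold_graph (insert v V) E"
| dominating: "threshold_graph V E \<Longrightarrow> v \<notin> V \<Longrightarrow>
    threshold_graph (insert v V) (E \<union> {{u, v} |u. u \<in> V})"

definition degree_of :: "'v set set \<Rightarrow> 'v \<Rightarrow> nat" where
  "degree_of E v = card {e \<in> E. v \<in> e}"

definition reverse_degree_labeled :: "nat \<Rightarrow> nat set set \<Rightarrow> bool" where
  "reverse_degree_labeled n E \<longleftrightarrow>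
     (\<forall>i\<in>{0..n}. \<forall>j\<in>{0..n}. i < j \<longrightarrow> degree_of E i \<ge> degree_of E j)"

definition is_path :: "'v set set \<Rightarrow> 'v \<Rightarrow> 'v list \<Rightarrow> 'v \<Rightarrow> bool" where
  "is_path E u p v \<longleftrightarrow> p \<noteq> [] \<and> hd p = u \<and> last p = v \<and> distinct p \<and>
     successively (\<lambda>x y. {x, y} \<in> E) p"

definition connected_graph :: "'v set \<Rightarrow> 'v set set \<Rightarrow> bool" where
  "connected_graph V E \<longleftrightarrow> (\<forall>u\<in>V. \<forall>v\<in>V. \<exists>p. is_path E u p v)"

definition num_components :: "'v set \<Rightarrow> 'v set set \<Rightarrow> nat" where
  "num_components V E = card (V // {(u, v). u \<in> V \<and> v \<in> V \<and> (\<exists>p. is_path E u p v)})"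

definition acyclic_graph :: "'v set set \<Rightarrow> bool" where
  "acyclic_graph E \<longleftrightarrow>
     \<not> (\<exists>u p v. is_path E u p v \<and> length p \<ge> 3 \<and> {v, u} \<in> E)"

definition spanning_trees :: "'v set \<Rightarrow> 'v set set \<Rightarrow> 'v set set set" where
  "spanning_trees V E = {T. T \<subseteq> E \<and> connected_graph V T \<and> acyclic_graph T}"


text \<open>Edges directed from the larger to the smaller endpoint.\<close>

definition directed_edges :: "nat set set \<Rightarrow> (nat \<times> nat) set" where
  "directed_edges E = {(i, j). i > j \<and> {i, j} \<in> E}"

definition net_flow :: "nat set set \<Rightarrow> (nat \<times> nat \<Rightarrow> real) \<Rightarrow> nat \<Rightarrow> real" where
  "net_flow E x k = (\<Sum>e\<in>{e \<in> directed_edges E. fst e = k}. x e)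
                  - (\<Sum>e\<in>{e \<in> directed_edges E. snd e = k}. x e)"

definition flow_polytope :: "nat \<Rightarrow> nat set set \<Rightarrow> (nat \<Rightarrow> real) \<Rightarrow> (nat \<times> nat \<Rightarrow> real) set" where
  "flow_polytope n E a = {x \<in> directed_edges E \<rightarrow>\<^sub>E {0..}.
     (\<forall>k\<in>{1..n}. net_flow E x k = a k) \<and> net_flow E x 0 = - (\<Sum>i=1..n. a i)}"

definition integer_flows :: "nat \<Rightarrow> nat set set \<Rightarrow> (nat \<Rightarrow> real) \<Rightarrow> (nat \<times> nat \<Rightarrow> real) set" where
  "integer_flows n E a = flow_polytope n E a \<inter> (directed_edges E \<rightarrow>\<^sub>E \<int>)"

text \<open>
  The parameters \<open>q\<close> and \<open>t\<close> are distinct elements of an integral domain with exact division, for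
  instance indeterminates, elements of a field, or the indeterminate of \<open>\<int>[q]\<close> and \<open>1\<close>.
  The division is exact by \<open>weight_mult\<close> below.
\<close>

definition weight :: "'a::idom_divide \<Rightarrow> 'a \<Rightarrow> nat \<Rightarrow> 'a" where
  "weight q t b = (if b = 0 then 1 else (q ^ b - t ^ b) div (q - t))"

lemma weight_mult:
  assumes "q \<noteq> t" "b > 0"
  shows "weight q t b * (q - t) = q ^ b - t ^ b"
proof -
  have "(q - t) dvd (q ^ b - t ^ b)"
    using assms(2) by (cases b) (simp_all only: power_diff_sumr2 dvd_triv_left)
  then obtain c where "q ^ b - t ^ b = (q - t) * c" ..
  then show ?thesis
    using assms by (simp add: weight_def)
qed

text \<open>
  The subtraction of \<open>n\<close> in the exponent does not truncate when all \<open>a k\<close> are positive,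
  by \<open>card_positive_edges\<close> below.
\<close>

definition flow_weight ::
    "nat \<Rightarrow> nat set set \<Rightarrow> 'a::idom_divide \<Rightarrow> 'a \<Rightarrow> (nat \<times> nat \<Rightarrow> real) \<Rightarrow> 'a" where
  "flow_weight n E q t A =
     (- ((1 - t) * (1 - q))) ^ (card {e \<in> directed_edges E. A e > 0} - n)
     * (\<Prod>e\<in>directed_edges E. weight q t (nat \<lfloor>A e\<rfloor>))"

lemma card_positive_edges:
  assumes "finite E" "\<forall>k\<in>{1..n}. a k > 0" "A \<in> flow_polytope n E a"
  shows "n \<le> card {e \<in> directed_edges E. A e > 0}"
proof -
  let ?P = "{e \<in> directed_edges E. A e > 0}"
  have "directed_edges E \<subseteq> (\<lambda>e. (Max e, Min e)) ` E"
  proof (clarsimp simp: directed_edges_def)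
    fix i j :: nat assume "j < i" "{i, j} \<in> E"
    then show "(i, j) \<in> (\<lambda>e. (Max e, Min e)) ` E"
      by (intro image_eqI[of _ _ "{i, j}"]) auto
  qed
  then have fin: "finite (directed_edges E)"
    using assms(1) finite_surj by blast
  have nonneg: "A e \<ge> 0" if "e \<in> directed_edges E" for e
    using assms(3) that by (cases e) (auto simp: flow_polytope_def PiE_def Pi_def)
  have "k \<in> fst ` ?P" if k: "k \<in> {1..n}" for k
  proof (rule ccontr)
    assume "k \<notin> fst ` ?P"
    then have "A e \<le> 0" if "e \<in> directed_edges E" "fst e = k" for e
      using that by (auto simp: not_less[symmetric])
    then have "(\<Sum>e\<in>{e \<in> directed_edges E. fst e = k}. A e) \<le> 0"
      by (intro sum_nonpos) auto
    moreover have "(\<Sum>e\<in>{e \<in> directed_edges E. snd e = k}. A e) \<ge> 0"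
      using nonneg by (intro sum_nonneg) auto
    ultimately have "net_flow E A k \<le> 0"
      by (simp add: net_flow_def)
    then show False
      using assms(2,3) k by (force simp: flow_polytope_def)
  qed
  then have "card {1..n} \<le> card (fst ` ?P)"
    using fin by (intro card_mono) auto
  also have "\<dots> \<le> card ?P"
    using fin by (intro card_image_le) auto
  finally show ?thesis by simp
qed

definition Ehr :: "nat \<Rightarrow> nat set set \<Rightarrow> (nat \<Rightarrow> real) \<Rightarrow> 'a::idom_divide \<Rightarrow> 'a \<Rightarrow> 'a" where
  "Ehr n E a q t = (\<Sum>A\<in>integer_flows n E a. flow_weight n E q t A)"


text \<open>
  A multigraph has a vertex set, a set of edge names, and a map sending each edge name to its
  set of endpoints. Both exponents below are nonnegative as integers.
\<close>

definition tutte :: "'v set \<Rightarrow> 'e set \<Rightarrow> ('e \<Rightarrow> 'v set) \<Rightarrow> 'a::comm_ring_1 \<Rightarrow> 'a \<Rightarrow> 'a" where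
  "tutte V E ends x y = (\<Sum>A\<in>Pow E.
     (x - 1) ^ (num_components V (ends ` A) - num_components V (ends ` E))
     * (y - 1) ^ (num_components V (ends ` A) + card A - card V))"

text \<open>
  The pairs \<open>(e, m)\<close> with \<open>m < a (Max e)\<close> are the parallel edges replacing \<open>e\<close>; the endpoint
  map is \<open>fst\<close>.
\<close>

definition parallel_edges :: "nat set set \<Rightarrow> (nat \<Rightarrow> nat) \<Rightarrow> (nat set \<times> nat) set" where
  "parallel_edges E a = (SIGMA e:E. {..<a (Max e)})"


text \<open>Trees are rooted at \<open>0\<close>.\<close>

definition tree_path :: "nat set set \<Rightarrow> nat \<Rightarrow> nat list" where
  "tree_path T v = (THE p. is_path T 0 p v)"

definition tree_parent :: "nat set set \<Rightarrow> nat \<Rightarrow> nat" where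
  "tree_parent T i = last (butlast (tree_path T i))"

definition descendant :: "nat set set \<Rightarrow> nat \<Rightarrow> nat \<Rightarrow> bool" where
  "descendant T v u \<longleftrightarrow> u \<in> set (tree_path T v)"

definition Inv :: "nat \<Rightarrow> nat set set \<Rightarrow> (nat \<times> nat) set" where
  "Inv n T = {(i, j). i \<in> {0..n} \<and> j \<in> {0..n} \<and> i \<noteq> 0 \<and> i > j \<and> descendant T j i}"

definition q_int :: "'a::comm_semiring_1 \<Rightarrow> nat \<Rightarrow> 'a" where
  "q_int q k = (\<Sum>i<k. q ^ i)"

definition tree_weight :: "nat \<Rightarrow> (nat \<Rightarrow> nat) \<Rightarrow> 'a::comm_ring_1 \<Rightarrow> nat set set \<Rightarrow> 'a" where
  "tree_weight n a q T = (\<Prod>e\<in>T. q_int q (a (Max e)))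
     * (\<Prod>(i, j)\<in>Inv n T. q ^ a (max (tree_parent T i) j))"

text \<open>The indeterminate of \<open>\<int>[q]\<close>.\<close>

abbreviation q_var :: "int poly" where
  "q_var \<equiv> [:0, 1:]"

end

theory Submission
  imports Defs
begin

text \<open>
  With \<open>x e = q ^ a (Max e)\<close>, all three quantities, multiplied by \<open>(q - 1) ^ n\<close>, equal the sum \<open>D V\<close> of
  \<open>\<Prod>e\<in>A. (x e - 1)\<close> over the edge sets \<open>A\<close> that connect \<open>V = {0..n}\<close>. For the Tutte polynomial at
  \<open>(1, q)\<close> one collapses parallel edges.

  Removing a vertex \<open>r\<close> and splitting off the component \<open>B\<close> of another vertex \<open>s\<close> gives
  \<open>D V = (\<Sum>B. (x(r, B) - 1) * D B * D (V - B))\<close>, where \<open>x(r, B)\<close> is the product of \<open>x\<close> over the edges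
  from \<open>r\<close> to \<open>B\<close>. The trees rooted at \<open>r\<close>, weighted by inversions, satisfy the same recursion: in a
  threshold graph labeled by reverse degree the neighbours of \<open>r\<close> in \<open>B\<close> form an initial segment of \<open>B\<close>,
  so the sum over the attaching vertex \<open>i \<in> B\<close> telescopes.

  At \<open>t = 1\<close> only the flows survive in which every vertex uses one outgoing edge. If vertex \<open>n\<close> sends its
  flow to \<open>j\<close>, deleting \<open>n\<close> increases \<open>a j\<close> by \<open>a n\<close>; the same recursion holds for \<open>D\<close>, by contracting
  \<open>n\<close> into its largest neighbour.
\<close>

subsection \<open>Connected edge sets and their generating polynomial\<close>

text \<open>The factor \<open>(q - 1) ^ n\<close> comes from
  \<open>(q - 1) * q_int q k = q ^ k - 1\<close>; for \<open>k > 0\<close>,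
  \<open>weight q 1 k\<close> satisfies the same equation. One factor \<open>q - 1\<close> per tree
  edge, or per edge with positive flow, turns its weight into a number of the form
  \<open>q ^ k - 1\<close>. In \<int>[q] the power of \<open>q - 1\<close> cancels at the end. The
  weights are \<open>x e - 1\<close> because parallel edges then collapse: the nonempty choices
  among two edges of weights \<open>x - 1\<close> and \<open>y - 1\<close> sum to
  \<open>x * y - 1\<close>. So \<open>k\<close> copies of weight \<open>q - 1\<close> make one edge
  of weight \<open>q ^ k - 1\<close>, and contracting a vertex into another adds exponents. The
  obstacle is that neither recursion stays among threshold graphs rooted at 0 with a fixed
  \<open>a\<close>: \<open>B\<close> is an arbitrary vertex set with an arbitrary root, and deleting
  a vertex changes \<open>a\<close>. Hence the recursions are stated for finite vertex sets, and the
  labeling enters only through \<open>shifted E\<close>, which can be used on every vertex subset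
  unchanged.\<close>

definition adj :: "'v set set \<Rightarrow> ('v \<times> 'v) set" where
  "adj A = {(x, y). {x, y} \<in> A}"

text \<open>Reachability composes more easily than the list paths of \<open>connected_graph\<close>;
  \<open>connected_graph_iff\<close> identifies the two. Walks may use all of \<open>A\<close>, so
  \<open>conn_poly\<close> and \<open>trees\<close> require \<open>A \<subseteq> Pow V\<close>
  separately.\<close>

definition conn :: "'v set \<Rightarrow> 'v set set \<Rightarrow> bool" where
  "conn V A \<longleftrightarrow> (\<forall>u\<in>V. \<forall>v\<in>V. (u, v) \<in> (adj A)\<^sup>*)"

definition component :: "'v set set \<Rightarrow> 'v \<Rightarrow> 'v set" where
  "component A s = (adj A)\<^sup>* `` {s}"

lemma adj_mono: "A \<subseteq> B \<Longrightarrow> (adj A)\<^sup>* \<subseteq> (adj B)\<^sup>*"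
  by (rule rtrancl_mono) (auto simp: adj_def)

lemma sym_adj: "sym ((adj A)\<^sup>*)"
  by (rule sym_rtrancl) (auto simp: adj_def sym_def insert_commute)

lemma adj_sym: "(u, v) \<in> (adj A)\<^sup>* \<Longrightarrow> (v, u) \<in> (adj A)\<^sup>*"
  using sym_adj by (metis symD)

lemma connI_root:
  assumes "\<And>v. v \<in> V \<Longrightarrow> (s, v) \<in> (adj A)\<^sup>*"
  shows "conn V A"
  unfolding conn_def using assms by (meson adj_sym rtrancl_trans)

lemma adj_closed:
  assumes "(u, v) \<in> (adj A)\<^sup>*" "u \<in> X" "\<And>x y. x \<in> X \<Longrightarrow> {x, y} \<in> A \<Longrightarrow> y \<in> X"
  shows "v \<in> X"
  using assms(1,2) by (induction) (auto simp: adj_def intro: assms(3))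

lemma edge_pair:
  assumes "card e = 2" "x \<in> e"
  obtains y where "e = {x, y}" "x \<noteq> y"
  using assms by (auto simp: card_2_iff insert_commute)

lemma edge_nonempty: "card e = 2 \<Longrightarrow> \<exists>v. v \<in> e"
  by (auto simp: card_2_iff)

lemma component_self: "s \<in> component A s"
  by (simp add: component_def)

lemma component_step: "x \<in> component A s \<Longrightarrow> {x, y} \<in> A \<Longrightarrow> y \<in> component A s"
  by (auto simp: component_def adj_def intro: rtrancl_into_rtrancl)

lemma component_subset:
  assumes "A \<subseteq> Pow V" "s \<in> V"
  shows "component A s \<subseteq> V"
  using adj_closed[of s _ A V] assms by (auto simp: component_def)

lemma component_edge:
  assumes "e \<in> A" "card e = 2" "x \<in> e" "x \<in> component A s"
  shows "e \<subseteq> component A s"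
  using assms edge_pair component_step by (metis insert_subset empty_subsetI)

lemma component_conn: "conn (component A s) (A \<inter> Pow (component A s))"
proof (rule connI_root)
  fix v assume "v \<in> component A s"
  then have "(s, v) \<in> (adj A)\<^sup>*" by (simp add: component_def)
  then show "(s, v) \<in> (adj (A \<inter> Pow (component A s)))\<^sup>*"
  proof (induction)
    case (step y z)
    then have "y \<in> component A s" by (simp add: component_def)
    moreover from this have "z \<in> component A s" using step(2) component_step by (auto simp: adj_def)
    ultimately have "(y, z) \<in> adj (A \<inter> Pow (component A s))"
      using step(2) by (auto simp: adj_def)
    with step(3) show ?case by (rule rtrancl_into_rtrancl)
  qed simp
qed

text \<open>No edge of \<open>A1 \<union> A2\<close> leaves \<open>B\<close>. This recovers
  \<open>B\<close> from the union, as the inverse half of the bijections behind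
  \<open>edge_prod_rec\<close> and \<open>sum_trees_rec\<close> requires.\<close>

lemma component_union:
  assumes "A1 \<subseteq> Pow B" "A2 \<subseteq> Pow (- B)" "conn B A1" "s \<in> B"
  shows "component (A1 \<union> A2) s = B"
proof
  show "component (A1 \<union> A2) s \<subseteq> B"
  proof
    fix v assume "v \<in> component (A1 \<union> A2) s"
    then have "(s, v) \<in> (adj (A1 \<union> A2))\<^sup>*" by (simp add: component_def)
    then show "v \<in> B" by (rule adj_closed) (use assms in auto)
  qed
  show "B \<subseteq> component (A1 \<union> A2) s"
    using assms(3,4) adj_mono[of A1 "A1 \<union> A2"] by (auto simp: conn_def component_def)
qed

lemma sum_Pow_insert:
  assumes "finite F" "e \<notin> F"
  shows "(\<Sum>A\<in>Pow (insert e F). g A) = (\<Sum>A\<in>Pow F. g A) + (\<Sum>A\<in>Pow F. g (insert e A))"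
proof -
  have "Pow F \<inter> insert e ` Pow F = {}" using assms by auto
  moreover have "inj_on (insert e) (Pow F)" using assms by (auto simp: inj_on_def)
  ultimately show ?thesis
    unfolding Pow_insert using assms by (simp add: sum.union_disjoint sum.reindex)
qed

text \<open>Expand each factor as \<open>1 + (x e - 1)\<close>.\<close>

lemma prod_eq_sum_Pow:
  fixes x :: "'e \<Rightarrow> 'a::comm_ring_1"
  assumes "finite F"
  shows "(\<Prod>e\<in>F. x e) = (\<Sum>A\<in>Pow F. \<Prod>e\<in>A. x e - 1)"
  using assms
proof (induction F)
  case (insert e F)
  have "(\<Sum>A\<in>Pow F. \<Prod>e\<in>insert e A. x e - 1) = (\<Sum>A\<in>Pow F. (x e - 1) * (\<Prod>e\<in>A. x e - 1))"
  proof (rule sum.cong)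
    fix A assume "A \<in> Pow F"
    then have "finite A" "e \<notin> A" using insert finite_subset by auto
    then show "(\<Prod>e\<in>insert e A. x e - 1) = (x e - 1) * (\<Prod>e\<in>A. x e - 1)" by simp
  qed simp
  then show ?case
    using insert by (simp add: sum_Pow_insert left_diff_distrib sum_subtractf sum_distrib_left)
qed simp

definition edge_prod :: "'v set set \<Rightarrow> ('v set \<Rightarrow> 'a::comm_ring_1) \<Rightarrow> 'v set \<Rightarrow> 'a" where
  "edge_prod E x V = (\<Prod>e\<in>E \<inter> Pow V. x e)"

text \<open>By \<open>prod_eq_sum_Pow\<close>, \<open>edge_prod\<close> is the same sum without the
  condition \<open>conn V A\<close>; the two are related as in the exponential formula.\<close>

definition conn_poly :: "'v set set \<Rightarrow> ('v set \<Rightarrow> 'a::comm_ring_1) \<Rightarrow> 'v set \<Rightarrow> 'a" where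
  "conn_poly E x V = (\<Sum>A | A \<subseteq> E \<inter> Pow V \<and> conn V A. \<Prod>e\<in>A. x e - 1)"

text \<open>An arbitrary edge set on \<open>V\<close> amounts to the component \<open>B\<close> of
  \<open>s\<close>, a connected edge set on \<open>B\<close> and an arbitrary one on
  \<open>V - B\<close>; no edge joins the two parts.\<close>

lemma edge_prod_rec:
  assumes fin: "finite V" and s: "s \<in> V" and E: "\<forall>e\<in>E. card e = 2"
  shows "edge_prod E x V = (\<Sum>B | s \<in> B \<and> B \<subseteq> V. conn_poly E x B * edge_prod E x (V - B))"
proof -
  let ?w = "\<lambda>A. \<Prod>e\<in>A. x e - 1"
  let ?C = "\<lambda>B. {A. A \<subseteq> E \<inter> Pow B \<and> conn B A}"
  let ?S = "SIGMA B:{B. s \<in> B \<and> B \<subseteq> V}. ?C B \<times> Pow (E \<inter> Pow (V - B))"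
  have finP: "finite (E \<inter> Pow B)" if "B \<subseteq> V" for B
    using fin that by (meson finite_Int finite_Pow_iff finite_subset)
  have finC: "finite (?C B)" if "B \<subseteq> V" for B
    by (rule finite_subset[OF _ iffD2[OF finite_Pow_iff finP[OF that]]]) auto
  have "edge_prod E x V = (\<Sum>A\<in>Pow (E \<inter> Pow V). ?w A)"
    unfolding edge_prod_def by (rule prod_eq_sum_Pow) (use finP in auto)
  also have "\<dots> = (\<Sum>(B, A1, A2)\<in>?S. ?w A1 * ?w A2)"
  proof (rule sum.reindex_bij_witness[where
        i = "\<lambda>(B, A1, A2). A1 \<union> A2" and
        j = "\<lambda>A. (component A s, A \<inter> Pow (component A s), A \<inter> Pow (V - component A s))"])
    fix A assume A: "A \<in> Pow (E \<inter> Pow V)"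
    let ?B = "component A s"
    have sub: "?B \<subseteq> V" using A s by (intro component_subset) auto
    have split: "A \<inter> Pow ?B \<union> A \<inter> Pow (V - ?B) = A"
    proof (intro equalityI subsetI)
      fix e assume e: "e \<in> A"
      then have "card e = 2" "e \<subseteq> V" using A E by auto
      then show "e \<in> A \<inter> Pow ?B \<union> A \<inter> Pow (V - ?B)"
        using e component_edge[OF e, of _ s] by blast
    qed auto
    then show "(case (?B, A \<inter> Pow ?B, A \<inter> Pow (V - ?B)) of (B, A1, A2) \<Rightarrow> A1 \<union> A2) = A" by simp
    show "(?B, A \<inter> Pow ?B, A \<inter> Pow (V - ?B)) \<in> ?S"
      using A sub component_self[of s A] component_conn[of A s] by auto
    have "?w (A \<inter> Pow ?B \<union> A \<inter> Pow (V - ?B)) = ?w (A \<inter> Pow ?B) * ?w (A \<inter> Pow (V - ?B))"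
    proof (rule prod.union_disjoint)
      have "finite A" using A finP[of V] by (meson PowD finite_subset order_refl)
      then show "finite (A \<inter> Pow ?B)" "finite (A \<inter> Pow (V - ?B))" by auto
      \<comment> \<open>The empty set would lie in both power sets; having two endpoints excludes
        it.\<close>
      have "\<exists>v. v \<in> e" if "e \<in> A" for e
        using that A E by (intro edge_nonempty) auto
      then show "A \<inter> Pow ?B \<inter> (A \<inter> Pow (V - ?B)) = {}" by blast
    qed
    then show "(case (?B, A \<inter> Pow ?B, A \<inter> Pow (V - ?B)) of (B, A1, A2) \<Rightarrow> ?w A1 * ?w A2) = ?w A"
      using split by simp
  next
    fix b assume "b \<in> ?S"
    then obtain B A1 A2 where b: "b = (B, A1, A2)" "s \<in> B" "B \<subseteq> V" "A1 \<subseteq> E \<inter> Pow B" "conn B A1"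
      "A2 \<subseteq> E \<inter> Pow (V - B)" by auto
    then have c: "component (A1 \<union> A2) s = B" by (intro component_union) auto
    have "\<exists>v. v \<in> e" if "e \<in> E" for e using that E by (intro edge_nonempty) auto
    then have "(A1 \<union> A2) \<inter> Pow B = A1" "(A1 \<union> A2) \<inter> Pow (V - B) = A2" using b by blast+
    then show "(\<lambda>A. (component A s, A \<inter> Pow (component A s), A \<inter> Pow (V - component A s)))
        (case b of (B, A1, A2) \<Rightarrow> A1 \<union> A2) = b"
      using b c by simp
    show "(case b of (B, A1, A2) \<Rightarrow> A1 \<union> A2) \<in> Pow (E \<inter> Pow V)" using b by auto
  qed
  also have "\<dots> = (\<Sum>B | s \<in> B \<and> B \<subseteq> V. \<Sum>(A1, A2)\<in>?C B \<times> Pow (E \<inter> Pow (V - B)). ?w A1 * ?w A2)"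
    by (subst sum.Sigma) (use fin finC finP in \<open>auto simp: split_def\<close>)
  also have "\<dots> = (\<Sum>B | s \<in> B \<and> B \<subseteq> V. conn_poly E x B * edge_prod E x (V - B))"
  proof (rule sum.cong)
    fix B assume "B \<in> {B. s \<in> B \<and> B \<subseteq> V}"
    then have "edge_prod E x (V - B) = (\<Sum>A\<in>Pow (E \<inter> Pow (V - B)). ?w A)"
      unfolding edge_prod_def by (intro prod_eq_sum_Pow) (use finP in auto)
    then show "(\<Sum>(A1, A2)\<in>?C B \<times> Pow (E \<inter> Pow (V - B)). ?w A1 * ?w A2) = conn_poly E x B * edge_prod E x (V - B)"
      by (simp add: conn_poly_def sum_product sum.cartesian_product)
  qed simp
  finally show ?thesis .
qed

subsection \<open>Recursions for the generating polynomial\<close>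

text \<open>Indexed by the far endpoint \<open>i\<close>, so that the factors are ordered for
  \<open>telescope_initial\<close>.\<close>

definition star_prod :: "'v set set \<Rightarrow> ('v set \<Rightarrow> 'a::comm_ring_1) \<Rightarrow> 'v \<Rightarrow> 'v set \<Rightarrow> 'a" where
  "star_prod E x r B = (\<Prod>i\<in>{i \<in> B. {r, i} \<in> E}. x {r, i})"

lemma star_prod_union:
  assumes "finite B" "finite C" "B \<inter> C = {}"
  shows "star_prod E x r (B \<union> C) = star_prod E x r B * star_prod E x r C"
proof -
  have "{i \<in> B \<union> C. {r, i} \<in> E} = {i \<in> B. {r, i} \<in> E} \<union> {i \<in> C. {r, i} \<in> E}" by auto
  then show ?thesis
    unfolding star_prod_def using assms by (simp add: prod.union_disjoint disjoint_iff)
qed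

lemma edge_prod_insert:
  assumes "finite W" "r \<notin> W" "\<forall>e\<in>E. card e = 2"
  shows "edge_prod E x (insert r W) = edge_prod E x W * star_prod E x r W"
proof -
  let ?S = "{i \<in> W. {r, i} \<in> E}"
  have "E \<inter> Pow (insert r W) = (E \<inter> Pow W) \<union> (\<lambda>i. {r, i}) ` ?S" (is "?l = ?r")
  proof (intro equalityI subsetI)
    fix e assume e: "e \<in> ?l"
    then have c: "card e = 2" using assms by auto
    show "e \<in> ?r"
    proof (cases "r \<in> e")
      case True
      then obtain y where "e = {r, y}" "r \<noteq> y" using c edge_pair by metis
      then show ?thesis using e by auto
    qed (use e in auto)
  qed auto
  moreover have "inj_on (\<lambda>i. {r, i}) ?S" by (auto simp: inj_on_def doubleton_eq_iff)
  moreover have "(E \<inter> Pow W) \<inter> (\<lambda>i. {r, i}) ` ?S = {}" using assms by auto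
  ultimately show ?thesis
    unfolding edge_prod_def star_prod_def using assms(1)
    by (simp add: prod.union_disjoint prod.reindex)
qed

lemma edge_prod_empty [simp]: "\<forall>e\<in>E. card e = 2 \<Longrightarrow> edge_prod E x {} = 1"
proof -
  assume "\<forall>e\<in>E. card e = 2"
  then have "E \<inter> Pow {} = {}" by force
  then show ?thesis by (simp add: edge_prod_def)
qed

lemma conn_poly_singleton:
  assumes "\<forall>e\<in>E. card e = 2"
  shows "conn_poly E x {v} = 1"
proof -
  have "E \<inter> Pow {v} = {}" using assms by (force simp: subset_singleton_iff)
  then have "{A. A \<subseteq> E \<inter> Pow {v} \<and> conn {v} A} = {{}}" by (auto simp: conn_def)
  then show ?thesis by (simp add: conn_poly_def)
qed

text \<open>
  Both recursions for \<open>conn_poly\<close> below are obtained from \<open>edge_prod_rec\<close> alone: that identity determines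
  \<open>conn_poly\<close>, so by induction it suffices that the right-hand sides satisfy it as well.
\<close>

lemma conn_poly_rec:
  assumes "finite V" "r \<in> V" "s \<in> V" "r \<noteq> s" and E: "\<forall>e\<in>E. card e = 2"
  shows "conn_poly E x V =
    (\<Sum>B | s \<in> B \<and> B \<subseteq> V - {r}. (star_prod E x r B - 1) * conn_poly E x B * conn_poly E x (V - B))"
  using assms(1-4)
proof (induction V rule: finite_psubset_induct)
  case (psubset V)
  let ?D = "conn_poly E x" and ?Z = "edge_prod E x" and ?m = "star_prod E x r"
  let ?R = "\<lambda>V. \<Sum>B | s \<in> B \<and> B \<subseteq> V - {r}. (?m B - 1) * ?D B * ?D (V - B)"
  let ?B = "{B. s \<in> B \<and> B \<subseteq> V - {r}}"
  let ?C = "{C. r \<in> C \<and> s \<in> C \<and> C \<subseteq> V}" and ?C' = "{C. r \<in> C \<and> s \<notin> C \<and> C \<subseteq> V}"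
  note fin = \<open>finite V\<close>
  have finB: "finite B" if "B \<subseteq> V" for B using fin that finite_subset by auto
  \<comment> \<open>\<open>C\<close> is the component of \<open>r\<close>; the two sums separate
    whether it contains \<open>s\<close>.\<close>
  have split: "?Z V = (\<Sum>C\<in>?C. ?D C * ?Z (V - C)) + (\<Sum>C\<in>?C'. ?D C * ?Z (V - C))"
  proof -
    have "{C. r \<in> C \<and> C \<subseteq> V} = ?C \<union> ?C'" by auto
    then show ?thesis
      unfolding edge_prod_rec[OF fin \<open>r \<in> V\<close> E]
      using fin by (simp add: sum.union_disjoint disjoint_iff)
  qed
  have inner: "(\<Sum>C | r \<in> C \<and> C \<subseteq> V - B. ?D C * ?Z (V - B - C)) = ?Z (V - B)" if "B \<in> ?B" for B
    using that fin \<open>r \<in> V\<close> E by (subst (2) edge_prod_rec[where s = r]) auto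
  \<comment> \<open>Cut \<open>C\<close> into \<open>B\<close> and \<open>C - B\<close>. For fixed
    \<open>B\<close> the sets \<open>C - B\<close> run over the possible components of
    \<open>r\<close> in \<open>V - B\<close>, so \<open>inner\<close> resums them.\<close>
  have A: "(\<Sum>C\<in>?C. ?R C * ?Z (V - C)) = (\<Sum>B\<in>?B. (?m B - 1) * ?D B * ?Z (V - B))"
  proof -
    have "(\<Sum>C\<in>?C. ?R C * ?Z (V - C))
        = (\<Sum>(C, B)\<in>(SIGMA C:?C. {B. s \<in> B \<and> B \<subseteq> C - {r}}). (?m B - 1) * ?D B * ?D (C - B) * ?Z (V - C))"
      unfolding sum_distrib_right
      by (rule sum.Sigma) (use fin finB in auto)
    also have "\<dots> = (\<Sum>(B, C)\<in>(SIGMA B:?B. {C. r \<in> C \<and> C \<subseteq> V - B}). (?m B - 1) * ?D B * (?D C * ?Z (V - B - C)))"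
    proof (rule sum.reindex_bij_witness[where j = "\<lambda>(C, B). (B, C - B)" and i = "\<lambda>(B, C). (B \<union> C, B)"])
      fix p assume p: "p \<in> (SIGMA C:?C. {B. s \<in> B \<and> B \<subseteq> C - {r}})"
      then obtain C B where [simp]: "p = (C, B)" and CB: "B \<subseteq> C" by auto
      have "V - B - (C - B) = V - C" using CB by auto
      then show "(case (case p of (C, B) \<Rightarrow> (B, C - B)) of
             (B, C) \<Rightarrow> (?m B - 1) * ?D B * (?D C * ?Z (V - B - C))) =
            (case p of (C, B) \<Rightarrow> (?m B - 1) * ?D B * ?D (C - B) * ?Z (V - C))"
        by (simp add: mult.assoc)
      show "(case (case p of (C, B) \<Rightarrow> (B, C - B)) of (B, C) \<Rightarrow> (B \<union> C, B)) = p" using CB by auto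
      show "(case p of (C, B) \<Rightarrow> (B, C - B)) \<in> (SIGMA B:?B. {C. r \<in> C \<and> C \<subseteq> V - B})" using p by auto
    qed auto
    also have "\<dots> = (\<Sum>B\<in>?B. \<Sum>C | r \<in> C \<and> C \<subseteq> V - B. (?m B - 1) * ?D B * (?D C * ?Z (V - B - C)))"
      by (rule sum.Sigma[symmetric]) (use fin finB in auto)
    also have "\<dots> = (\<Sum>B\<in>?B. (?m B - 1) * ?D B * ?Z (V - B))"
      using inner by (intro sum.cong refl) (simp flip: sum_distrib_left)
    finally show ?thesis .
  qed
  \<comment> \<open>If \<open>C\<close> misses \<open>s\<close>, split the component
    \<open>B\<close> of \<open>s\<close> off the rest, then sum over \<open>C\<close> first.\<close>
  have B: "(\<Sum>C\<in>?C'. ?D C * ?Z (V - C)) = (\<Sum>B\<in>?B. ?D B * ?Z (V - B))"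
  proof -
    have "(\<Sum>C\<in>?C'. ?D C * ?Z (V - C)) = (\<Sum>C\<in>?C'. \<Sum>B | s \<in> B \<and> B \<subseteq> V - C. ?D C * (?D B * ?Z (V - C - B)))"
    proof (rule sum.cong)
      fix C assume "C \<in> ?C'"
      then show "?D C * ?Z (V - C) = (\<Sum>B | s \<in> B \<and> B \<subseteq> V - C. ?D C * (?D B * ?Z (V - C - B)))"
        using fin \<open>s \<in> V\<close> E by (subst edge_prod_rec[where s = s]) (auto simp: sum_distrib_left)
    qed simp
    also have "\<dots> = (\<Sum>(C, B)\<in>(SIGMA C:?C'. {B. s \<in> B \<and> B \<subseteq> V - C}). ?D C * (?D B * ?Z (V - C - B)))"
      by (rule sum.Sigma) (use fin finB in auto)
    also have "\<dots> = (\<Sum>(B, C)\<in>(SIGMA B:?B. {C. r \<in> C \<and> C \<subseteq> V - B}). ?D B * (?D C * ?Z (V - B - C)))"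
      by (rule sum.reindex_bij_witness[where j = "\<lambda>(C, B). (B, C)" and i = "\<lambda>(B, C). (C, B)"])
         (auto simp: Diff_eq Int_ac mult_ac)
    also have "\<dots> = (\<Sum>B\<in>?B. \<Sum>C | r \<in> C \<and> C \<subseteq> V - B. ?D B * (?D C * ?Z (V - B - C)))"
      by (rule sum.Sigma[symmetric]) (use fin finB in auto)
    also have "\<dots> = (\<Sum>B\<in>?B. ?D B * ?Z (V - B))"
      using inner by (intro sum.cong refl) (simp flip: sum_distrib_left)
    finally show ?thesis .
  qed
  \<comment> \<open>Adding \<open>A\<close> and \<open>B\<close> cancels the \<open>- 1\<close>,
    which leaves this sum. The edges from \<open>r\<close> to \<open>B\<close> are exactly the edges
    at \<open>r\<close> that \<open>?Z (V - B)\<close> lacks, so all edges at \<open>r\<close>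
    factor out.\<close>
  have "(\<Sum>B\<in>?B. ?m B * ?D B * ?Z (V - B)) = (\<Sum>B\<in>?B. ?m (V - {r}) * (?D B * ?Z (V - {r} - B)))"
  proof (rule sum.cong)
    fix B assume "B \<in> ?B"
    then have b: "V - B = insert r (V - {r} - B)" "V - {r} = B \<union> (V - {r} - B)" "finite B"
      using \<open>r \<in> V\<close> finB by auto
    have "?Z (V - B) = ?Z (V - {r} - B) * ?m (V - {r} - B)"
      unfolding b(1) by (rule edge_prod_insert) (use fin E in auto)
    moreover have "?m (V - {r}) = ?m B * ?m (V - {r} - B)"
      by (subst b(2), rule star_prod_union) (use b fin in auto)
    ultimately show "?m B * ?D B * ?Z (V - B) = ?m (V - {r}) * (?D B * ?Z (V - {r} - B))"
      by (simp add: mult_ac)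
  qed simp
  also have "\<dots> = ?m (V - {r}) * ?Z (V - {r})"
    using fin psubset E by (subst (2) edge_prod_rec[where s = s]) (auto simp: sum_distrib_left)
  also have "\<dots> = ?Z V"
    using edge_prod_insert[of "V - {r}" r E x] fin \<open>r \<in> V\<close> E by (simp add: insert_absorb mult_ac)
  finally have "?Z V = (\<Sum>C\<in>?C. ?R C * ?Z (V - C)) + (\<Sum>C\<in>?C'. ?D C * ?Z (V - C))"
    unfolding A B by (simp add: algebra_simps sum_subtractf)
  with split have eq: "(\<Sum>C\<in>?C. ?D C * ?Z (V - C)) = (\<Sum>C\<in>?C. ?R C * ?Z (V - C))" by simp
  have V: "V \<in> ?C" using psubset by auto
  have finC: "finite ?C" using fin by simp
  \<comment> \<open>Proper subsets \<open>C\<close> agree by induction; the remaining term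
    \<open>C = V\<close> carries the factor \<open>edge_prod E x {} = 1\<close>.\<close>
  have rest: "(\<Sum>C\<in>?C - {V}. ?D C * ?Z (V - C)) = (\<Sum>C\<in>?C - {V}. ?R C * ?Z (V - C))"
  proof (rule sum.cong)
    fix C assume "C \<in> ?C - {V}"
    then have "?D C = ?R C" using psubset.prems by (intro psubset.IH) auto
    then show "?D C * ?Z (V - C) = ?R C * ?Z (V - C)" by simp
  qed simp
  from eq show ?case
    unfolding sum.remove[OF finC V] rest using E by simp
qed

text \<open>The summand at \<open>i\<close> is the difference of the products over
  \<open>{j \<in> S. j \<le> i}\<close> and \<open>{j \<in> S. j < i}\<close>.\<close>

lemma telescope_initial:
  fixes x :: "'i::linorder \<Rightarrow> 'a::comm_ring_1"
  assumes "finite S"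
  shows "(\<Sum>i\<in>S. (x i - 1) * (\<Prod>j\<in>{j \<in> S. j < i}. x j)) = (\<Prod>i\<in>S. x i) - 1"
  using assms
proof (induction S rule: finite_linorder_max_induct)
  case (insert b S)
  have "{j \<in> insert b S. j < i} = {j \<in> S. j < i}" if "i \<in> S" for i
    using insert(2) that by force
  moreover have "{j \<in> insert b S. j < b} = S" using insert(2) by auto
  moreover have "b \<notin> S" using insert by auto
  ultimately show ?case using insert(1,3) by (simp add: algebra_simps)
qed simp

text \<open>The shifted families of extremal combinatorics: moving an endpoint down keeps an edge.
  The clause \<open>k \<noteq> i\<close> avoids loops.\<close>

definition shifted :: "nat set set \<Rightarrow> bool" where
  "shifted E \<longleftrightarrow> (\<forall>i j k. i < j \<and> k \<noteq> i \<and> {j, k} \<in> E \<longrightarrow> {i, k} \<in> E)"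

abbreviation max_wt :: "'a::comm_ring_1 \<Rightarrow> (nat \<Rightarrow> nat) \<Rightarrow> nat set \<Rightarrow> 'a" where
  "max_wt q a \<equiv> (\<lambda>e. q ^ a (Max e))"

section \<open>Contraction of the largest vertex\<close>

lemma edge_prod_cong:
  assumes "\<And>e. e \<in> E \<Longrightarrow> e \<subseteq> V \<Longrightarrow> x e = y e"
  shows "edge_prod E x V = edge_prod E y V"
  unfolding edge_prod_def by (rule prod.cong) (use assms in auto)

text \<open>The update touches exactly the edges with maximum \<open>j\<close>, and these are all
  pairs \<open>{j, i}\<close> with \<open>i < j\<close> in \<open>V\<close>.\<close>

lemma edge_prod_raise:
  assumes "finite V" "j \<in> V" "\<forall>e\<in>E. card e = 2"
    and "\<And>i. i < j \<Longrightarrow> {j, i} \<in> E"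
  shows "edge_prod E (max_wt q (a(j := a j + c))) V
       = edge_prod E (max_wt q a) V * (\<Prod>i\<in>{i \<in> V. i < j}. q ^ c)"
proof -
  let ?S = "{i \<in> V. i < j}" and ?b = "a(j := a j + c)"
  have *: "{e \<in> E \<inter> Pow V. Max e = j} = (\<lambda>i. {j, i}) ` ?S" (is "?l = ?r")
  proof (intro equalityI subsetI)
    fix e assume e: "e \<in> ?l"
    then have c: "card e = 2" "Max e = j" using assms by auto
    then have f: "finite e" "e \<noteq> {}" using card.infinite by force+
    then have "j \<in> e" using c Max_in by metis
    then obtain y where y: "e = {j, y}" "j \<noteq> y" using c edge_pair by metis
    moreover have "y \<le> Max e" using f y by (intro Max_ge) auto
    ultimately show "e \<in> ?r" using e c by auto
  qed (use assms in \<open>auto simp: max_def\<close>)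
  have inj: "inj_on (\<lambda>i. {j, i}) ?S" by (auto simp: inj_on_def doubleton_eq_iff)
  have fin: "finite (E \<inter> Pow V)" using assms by simp
  have "edge_prod E (max_wt q ?b) V = (\<Prod>e\<in>E \<inter> Pow V. max_wt q a e * (if Max e = j then q ^ c else 1))"
    unfolding edge_prod_def by (rule prod.cong) (auto simp: power_add)
  also have "\<dots> = edge_prod E (max_wt q a) V * (\<Prod>e\<in>{e \<in> E \<inter> Pow V. Max e = j}. q ^ c)"
    unfolding prod.distrib edge_prod_def using fin by (simp flip: prod.inter_filter)
  also have "(\<Prod>e\<in>{e \<in> E \<inter> Pow V. Max e = j}. q ^ c) = (\<Prod>i\<in>?S. q ^ c)"
    unfolding * prod.reindex[OF inj] by simp
  finally show ?thesis .
qed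

text \<open>
  Contracting the last vertex \<open>m\<close> into its largest neighbour \<open>j\<close>: every \<open>i < j\<close> is adjacent to both
  \<open>m\<close> and \<open>j\<close>, so the contraction is again of the form \<open>max_wt\<close>.
\<close>

lemma conn_poly_contract:
  fixes q :: "'a::comm_ring_1"
  assumes E: "\<forall>e\<in>E. card e = 2" and sh: "shifted E"
    and "finite V" "V \<noteq> {}" "\<And>v. v \<in> V \<Longrightarrow> v < m"
  shows "conn_poly E (max_wt q a) (insert m V) =
    (\<Sum>j\<in>{j \<in> V. {m, j} \<in> E}. (q ^ a m - 1) * conn_poly E (max_wt q (a(j := a j + a m))) V)"
  using assms(3-5)
proof (induction V rule: finite_psubset_induct)
  case (psubset V)
  let ?b = "\<lambda>j. a(j := a j + a m)"
  let ?D = "conn_poly E (max_wt q a)" and ?Z = "edge_prod E (max_wt q a)"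
  let ?N = "\<lambda>V. {j \<in> V. {m, j} \<in> E}"
  let ?R = "\<lambda>V. \<Sum>j\<in>?N V. (q ^ a m - 1) * conn_poly E (max_wt q (?b j)) V"
  note fin = \<open>finite V\<close>
  have m: "m \<notin> V" using psubset.prems by auto
  \<comment> \<open>Shiftedness is applied twice: \<open>{m, j}\<close> gives \<open>{m, i}\<close>,
    and this gives \<open>{j, i}\<close> because \<open>j < m\<close>.\<close>
  have adjm: "{j, i} \<in> E" if "j \<in> ?N V" "i < j" for i j
  proof -
    have j: "j < m" "{j, m} \<in> E" using that psubset.prems by (auto simp: insert_commute)
    have "{i, m} \<in> E" using sh j that unfolding shifted_def by (metis less_irrefl less_trans)
    then have "{m, i} \<in> E" by (simp add: insert_commute)
    then show "{j, i} \<in> E" using sh j that unfolding shifted_def by (metis less_irrefl)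
  qed
  have "?Z (insert m V) = (\<Sum>B | m \<in> B \<and> B \<subseteq> insert m V. ?D B * ?Z (insert m V - B))"
    by (rule edge_prod_rec) (use fin E in auto)
  also have "\<dots> = (\<Sum>B\<in>Pow V. ?D (insert m B) * ?Z (V - B))"
  proof -
    have "V - (B - {m}) = V - B" for B using m by auto
    then show ?thesis
      by (intro sum.reindex_bij_witness[where i = "insert m" and j = "\<lambda>B. B - {m}"])
         (use m in \<open>auto simp: insert_absorb\<close>)
  qed
  \<comment> \<open>\<open>B = {}\<close> is set apart because the claim fails for it:
    \<open>?D {m}\<close> is 1, whereas \<open>?R {}\<close> is an empty sum.\<close>
  also have "\<dots> = ?D {m} * ?Z V + (\<Sum>B\<in>Pow V - {{}}. ?D (insert m B) * ?Z (V - B))"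
    by (subst sum.remove[of _ "{}"]) (use fin in auto)
  finally have 1: "?Z (insert m V) = ?Z V + (\<Sum>B\<in>Pow V - {{}}. ?D (insert m B) * ?Z (V - B))"
    using conn_poly_singleton[OF E, of "max_wt q a" m] by simp
  have "(\<Sum>B\<in>Pow V - {{}}. ?R B * ?Z (V - B)) = (\<Sum>B\<in>Pow V. ?R B * ?Z (V - B))"
    by (subst sum.remove[of "Pow V" "{}"]) (use fin in auto)
  also have "\<dots> = (\<Sum>B\<in>Pow V. \<Sum>j\<in>?N V. if j \<in> B then
      (q ^ a m - 1) * (conn_poly E (max_wt q (?b j)) B * edge_prod E (max_wt q (?b j)) (V - B)) else 0)"
  proof (rule sum.cong)
    fix B assume B: "B \<in> Pow V"
    \<comment> \<open>An edge avoiding \<open>B\<close> has its maximum outside \<open>B\<close>, so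
      raising \<open>a\<close> at a vertex of \<open>B\<close> does not affect it.\<close>
    have Z: "edge_prod E (max_wt q (?b j)) (V - B) = ?Z (V - B)" if "j \<in> B" for j
    proof (rule edge_prod_cong)
      fix e assume e: "e \<in> E" "e \<subseteq> V - B"
      then have "card e = 2" "finite e" using E by (auto intro: card_ge_0_finite)
      then have "Max e \<in> e" by (intro Max_in) auto
      then have "Max e \<noteq> j" using e that by auto
      then show "q ^ ?b j (Max e) = q ^ a (Max e)" by simp
    qed
    have "?N B = {j \<in> ?N V. j \<in> B}" using B by auto
    then have "?R B * ?Z (V - B) = (\<Sum>j\<in>{j \<in> ?N V. j \<in> B}.
        (q ^ a m - 1) * (conn_poly E (max_wt q (?b j)) B * edge_prod E (max_wt q (?b j)) (V - B)))"
      using Z by (simp add: sum_distrib_right mult.assoc)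
    also have "\<dots> = (\<Sum>j\<in>?N V. if j \<in> B then
      (q ^ a m - 1) * (conn_poly E (max_wt q (?b j)) B * edge_prod E (max_wt q (?b j)) (V - B)) else 0)"
      by (rule sum.inter_filter) (use fin in auto)
    finally show "?R B * ?Z (V - B) = \<dots>" .
  qed simp
  \<comment> \<open>With \<open>j\<close> outermost, the sum over all \<open>B\<close> containing
    \<open>j\<close> is \<open>edge_prod_rec\<close> for the raised weights, taken at
    \<open>s = j\<close>.\<close>
  also have "\<dots> = (\<Sum>j\<in>?N V. \<Sum>B\<in>Pow V. if j \<in> B then
      (q ^ a m - 1) * (conn_poly E (max_wt q (?b j)) B * edge_prod E (max_wt q (?b j)) (V - B)) else 0)"
    by (rule sum.swap)
  also have "\<dots> = (\<Sum>j\<in>?N V. (q ^ a m - 1) * edge_prod E (max_wt q (?b j)) V)"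
  proof (rule sum.cong)
    fix j assume j: "j \<in> ?N V"
    have "{B. j \<in> B \<and> B \<subseteq> V} = {B \<in> Pow V. j \<in> B}" by auto
    then show "(\<Sum>B\<in>Pow V. if j \<in> B then
      (q ^ a m - 1) * (conn_poly E (max_wt q (?b j)) B * edge_prod E (max_wt q (?b j)) (V - B)) else 0)
      = (q ^ a m - 1) * edge_prod E (max_wt q (?b j)) V"
      using edge_prod_rec[OF fin, of j E "max_wt q (?b j)"] j E fin
      by (simp add: sum_distrib_left flip: sum.inter_filter)
  qed simp
  also have "\<dots> = ?Z V * (\<Sum>j\<in>?N V. (q ^ a m - 1) * (\<Prod>i\<in>{i \<in> ?N V. i < j}. q ^ a m))"
    unfolding sum_distrib_left
  proof (rule sum.cong)
    fix j assume j: "j \<in> ?N V"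
    \<comment> \<open>Shiftedness turns the factors from \<open>edge_prod_raise\<close>, one per
      \<open>i < j\<close> in \<open>V\<close>, into those of \<open>telescope_initial\<close>, one
      per neighbour \<open>i < j\<close> of \<open>m\<close>.\<close>
    have "{i \<in> ?N V. i < j} = {i \<in> V. i < j}"
    proof -
      have "{m, i} \<in> E" if "i < j" "i \<in> V" for i
        using sh j that m unfolding shifted_def by (metis (mono_tags, lifting) insert_commute mem_Collect_eq)
      then show ?thesis by auto
    qed
    then show "(q ^ a m - 1) * edge_prod E (max_wt q (?b j)) V
      = ?Z V * ((q ^ a m - 1) * (\<Prod>i\<in>{i \<in> ?N V. i < j}. q ^ a m))"
      using edge_prod_raise[of V j E q a "a m", OF fin _ E adjm[OF j]] j by (simp add: mult_ac)
  qed simp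
  also have "\<dots> = ?Z V * ((\<Prod>i\<in>?N V. q ^ a m) - 1)"
    by (subst telescope_initial) (use fin in auto)
  also have "\<dots> = ?Z (insert m V) - ?Z V"
  proof -
    have "star_prod E (max_wt q a) m V = (\<Prod>i\<in>?N V. q ^ a m)"
      unfolding star_prod_def
      by (rule prod.cong) (use psubset.prems in \<open>auto simp: max_def dest: less_imp_le leD\<close>)
    then show ?thesis
      using edge_prod_insert[OF fin m E, of "max_wt q a"] by (simp add: algebra_simps)
  qed
  finally have eq: "(\<Sum>B\<in>Pow V - {{}}. ?R B * ?Z (V - B)) = (\<Sum>B\<in>Pow V - {{}}. ?D (insert m B) * ?Z (V - B))"
    unfolding 1 by simp
  have V: "V \<in> Pow V - {{}}" "finite (Pow V - {{}})" using psubset.prems fin by auto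
  have rest: "(\<Sum>B\<in>Pow V - {{}} - {V}. ?R B * ?Z (V - B)) = (\<Sum>B\<in>Pow V - {{}} - {V}. ?D (insert m B) * ?Z (V - B))"
  proof (rule sum.cong)
    fix B assume "B \<in> Pow V - {{}} - {V}"
    then have "?D (insert m B) = ?R B" using psubset.prems by (intro psubset.IH) auto
    then show "?R B * ?Z (V - B) = ?D (insert m B) * ?Z (V - B)" by simp
  qed simp
  from eq show ?case unfolding sum.remove[OF V(2,1)] rest using E by simp
qed

subsection \<open>Decomposition of spanning trees at the root\<close>

lemma conn_split:
  assumes A: "A \<subseteq> Pow V" and two: "\<forall>e\<in>A. card e = 2" and c: "conn V A"
    and rs: "r \<in> V" "s \<in> V" "r \<noteq> s" and B: "B = component (A \<inter> Pow (V - {r})) s"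
  shows "s \<in> B" "B \<subseteq> V - {r}" "conn B (A \<inter> Pow B)" "conn (V - B) (A \<inter> Pow (V - B))"
    "\<exists>i\<in>B. {r, i} \<in> A" "A = A \<inter> Pow B \<union> A \<inter> Pow (V - B) \<union> (\<lambda>i. {r, i}) ` {i \<in> B. {r, i} \<in> A}"
proof -
  let ?A = "A \<inter> Pow (V - {r})"
  show sB: "s \<in> B" unfolding B by (rule component_self)
  show sub: "B \<subseteq> V - {r}" unfolding B by (rule component_subset) (use rs in auto)
  have "?A \<inter> Pow B = A \<inter> Pow B" using sub by auto
  then show "conn B (A \<inter> Pow B)" using component_conn[of ?A s] unfolding B by simp
  have out: "y = r \<or> y \<in> B" if "x \<in> B" "{x, y} \<in> A" for x y
    using that component_step[of x ?A s y] A sub unfolding B by blast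
  show "\<exists>i\<in>B. {r, i} \<in> A"
  proof (rule ccontr)
    assume no: "\<not> ?thesis"
    have "(s, r) \<in> (adj A)\<^sup>*" using c rs by (auto simp: conn_def)
    then have "r \<in> B"
      by (rule adj_closed) (use sB out no in \<open>auto simp: insert_commute\<close>)
    then show False using sub by auto
  qed
  show "conn (V - B) (A \<inter> Pow (V - B))"
  proof (rule connI_root[where s = r])
    fix v assume v: "v \<in> V - B"
    let ?X = "component (A \<inter> Pow (V - B)) r"
    have X: "?X \<subseteq> V - B" using rs sub by (intro component_subset) auto
    have "(r, v) \<in> (adj A)\<^sup>*" using c rs v by (auto simp: conn_def)
    \<comment> \<open>\<open>?X \<union> B\<close> is closed under edges: one that leaves
      \<open>B\<close> ends in \<open>r\<close>, which lies in \<open>?X\<close>.\<close>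
    then have "v \<in> ?X \<union> B"
    proof (rule adj_closed)
      fix x y assume x: "x \<in> ?X \<union> B" "{x, y} \<in> A"
      then have "y \<in> V" using A by auto
      then show "y \<in> ?X \<union> B"
        using x out[of x y] component_step[of x "A \<inter> Pow (V - B)" r y] X component_self[of r "A \<inter> Pow (V - B)"]
        by blast
    qed (simp add: component_self)
    then show "(r, v) \<in> (adj (A \<inter> Pow (V - B)))\<^sup>*" using v by (auto simp: component_def)
  qed
  show "A = A \<inter> Pow B \<union> A \<inter> Pow (V - B) \<union> (\<lambda>i. {r, i}) ` {i \<in> B. {r, i} \<in> A}" (is "A = ?R")
  proof (intro equalityI subsetI)
    fix e assume e: "e \<in> A"
    show "e \<in> ?R"
    proof (cases "e \<inter> B = {}")
      case True
      then show ?thesis using e A by blast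
    next
      case False
      then obtain x where x: "x \<in> e" "x \<in> B" by auto
      then obtain y where y: "e = {x, y}" "x \<noteq> y" using two e edge_pair by metis
      then show ?thesis using out[of x y] x e by (auto simp: insert_commute)
    qed
  qed auto
qed

lemma conn_compose:
  assumes "conn B A1" "conn C A2" "i \<in> B" "r \<in> C" "V = B \<union> C"
    "A1 \<subseteq> A" "A2 \<subseteq> A" "{r, i} \<in> A"
  shows "conn V A"
proof (rule connI_root[where s = r])
  fix v assume "v \<in> V"
  then consider "v \<in> C" | "v \<in> B" using assms by auto
  then show "(r, v) \<in> (adj A)\<^sup>*"
  proof cases
    case 1
    then show ?thesis using assms(2,4) adj_mono[OF assms(7)] by (auto simp: conn_def)
  next
    case 2
    then have "(i, v) \<in> (adj A)\<^sup>*" using assms(1,3) adj_mono[OF assms(6)] by (auto simp: conn_def)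
    moreover have "(r, i) \<in> adj A" using assms by (simp add: adj_def)
    ultimately show ?thesis by (rule converse_rtrancl_into_rtrancl[rotated])
  qed
qed

section \<open>Edge counts of connected sets and trees\<close>

lemma finite_edges:
  assumes "finite V" "A \<subseteq> Pow V" shows "finite A"
  using assms by (meson finite_Pow_iff finite_subset)

lemma card_split:
  assumes fin: "finite V" and A: "A \<subseteq> Pow V" and two: "\<forall>e\<in>A. card e = 2"
    and "B \<subseteq> V - {r}"
    and split: "A = A \<inter> Pow B \<union> A \<inter> Pow (V - B) \<union> (\<lambda>i. {r, i}) ` {i \<in> B. {r, i} \<in> A}"
  shows "card A = card (A \<inter> Pow B) + card (A \<inter> Pow (V - B)) + card {i \<in> B. {r, i} \<in> A}"
proof -
  let ?S = "{i \<in> B. {r, i} \<in> A}"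
  have ne: "\<exists>v. v \<in> e" if "e \<in> A" for e using that two by (intro edge_nonempty) auto
  have finA: "finite A" using fin A by (rule finite_edges)
  have finS: "finite ?S" using fin assms(4) finite_subset by fastforce
  have "inj_on (\<lambda>i. {r, i}) ?S" by (auto simp: inj_on_def doubleton_eq_iff)
  then have "card ((\<lambda>i. {r, i}) ` ?S) = card ?S" by (rule card_image)
  moreover have "(A \<inter> Pow B \<union> A \<inter> Pow (V - B)) \<inter> (\<lambda>i. {r, i}) ` ?S = {}" using assms(4) by auto
  moreover have "(A \<inter> Pow B) \<inter> (A \<inter> Pow (V - B)) = {}" using ne by blast
  ultimately show ?thesis
    using finA finS by (subst split) (simp add: card_Un_disjoint)
qed

lemma card_subset_Diff:
  assumes "finite V" "B \<subseteq> V"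
  shows "card V = card B + card (V - B)"
  using assms by (simp add: card_Diff_subset card_mono finite_subset)

text \<open>Induction along \<open>conn_split\<close>: both parts obey the bound, and at least one
  edge joins \<open>r\<close> to \<open>B\<close>.\<close>

lemma card_conn:
  assumes "finite V" "V \<noteq> {}" "A \<subseteq> Pow V" "\<forall>e\<in>A. card e = 2" "conn V A"
  shows "card V \<le> card A + 1"
  using assms
proof (induction V arbitrary: A rule: finite_psubset_induct)
  case (psubset V)
  show ?case
  proof (cases "\<exists>r s. r \<in> V \<and> s \<in> V \<and> r \<noteq> s")
    case False
    then have "card V \<le> 1" by (metis One_nat_def card_le_Suc0_iff_eq psubset.hyps)
    then show ?thesis by simp
  next
    case True
    then obtain r s where rs: "r \<in> V" "s \<in> V" "r \<noteq> s" by auto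
    define B where B: "B = component (A \<inter> Pow (V - {r})) s"
    note sp = conn_split[OF psubset.prems(2-4) rs B]
    have finS: "finite {i \<in> B. {r, i} \<in> A}" using psubset.hyps sp(2) finite_subset by fastforce
    have "card B \<le> card (A \<inter> Pow B) + 1"
      by (rule psubset.IH) (use sp(1-5) rs psubset.prems in auto)
    moreover have "card (V - B) \<le> card (A \<inter> Pow (V - B)) + 1"
      by (rule psubset.IH) (use sp(1-5) rs psubset.prems in auto)
    moreover have "card {i \<in> B. {r, i} \<in> A} \<ge> 1"
      using sp(5) finS by (metis (mono_tags, lifting) One_nat_def Suc_leI card_gt_0_iff empty_iff mem_Collect_eq)
    moreover have "card V = card B + card (V - B)"
      using sp(2) psubset.hyps by (intro card_subset_Diff) auto
    ultimately show ?thesis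
      using card_split[OF psubset.hyps(1) psubset.prems(2,3) sp(2,6)] by simp
  qed
qed

text \<open>Counting edges replaces acyclicity, because cardinalities add up under
  \<open>conn_split\<close>; \<open>spanning_trees_eq\<close> shows the agreement with
  \<open>spanning_trees\<close>.\<close>

definition trees :: "'v set set \<Rightarrow> 'v set \<Rightarrow> 'v set set set" where
  "trees E V = {T. T \<subseteq> E \<inter> Pow V \<and> conn V T \<and> card T + 1 = card V}"

text \<open>The total is the least possible, so both bounds from \<open>card_conn\<close> are
  attained and exactly one edge joins \<open>r\<close> to \<open>B\<close>.\<close>

lemma tree_split:
  assumes fin: "finite V" and E: "\<forall>e\<in>E. card e = 2" and T: "T \<in> trees E V"
    and rs: "r \<in> V" "s \<in> V" "r \<noteq> s" and B: "B = component (T \<inter> Pow (V - {r})) s"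
  shows "s \<in> B" "B \<subseteq> V - {r}" "T \<inter> Pow B \<in> trees E B" "T \<inter> Pow (V - B) \<in> trees E (V - B)"
    "\<exists>i\<in>B. {i \<in> B. {r, i} \<in> T} = {i} \<and> {r, i} \<in> E \<and> T = insert {r, i} (T \<inter> Pow B \<union> T \<inter> Pow (V - B))"
proof -
  have T': "T \<subseteq> Pow V" "\<forall>e\<in>T. card e = 2" "conn V T" "card T + 1 = card V" "T \<subseteq> E"
    using T E by (auto simp: trees_def)
  note sp = conn_split[OF T'(1-3) rs B]
  show "s \<in> B" "B \<subseteq> V - {r}" by (fact sp)+
  let ?S = "{i \<in> B. {r, i} \<in> T}"
  have finS: "finite ?S" "finite B" using fin sp(2) finite_subset by fastforce+
  have 1: "card B \<le> card (T \<inter> Pow B) + 1"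
    by (rule card_conn) (use sp(1-5) finS T' in auto)
  have 2: "card (V - B) \<le> card (T \<inter> Pow (V - B)) + 1"
    by (rule card_conn) (use sp(1-5) fin rs T' in auto)
  have 3: "card ?S \<ge> 1"
    using sp(5) finS by (metis (mono_tags, lifting) One_nat_def Suc_leI card_gt_0_iff empty_iff mem_Collect_eq)
  have "card V = card B + card (V - B)"
    using sp(2) fin by (intro card_subset_Diff) auto
  then have 4: "card (T \<inter> Pow B) + 1 = card B" "card (T \<inter> Pow (V - B)) + 1 = card (V - B)" "card ?S = 1"
    using 1 2 3 T'(4) card_split[OF fin T'(1,2) sp(2,6)] by linarith+
  show "T \<inter> Pow B \<in> trees E B" "T \<inter> Pow (V - B) \<in> trees E (V - B)"
    using 4 sp(1-5) T' by (auto simp: trees_def)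
  obtain i where i: "?S = {i}" using 4(3) card_1_singletonE by blast
  then have "i \<in> B" "{r, i} \<in> T" by auto
  then show "\<exists>i\<in>B. ?S = {i} \<and> {r, i} \<in> E \<and> T = insert {r, i} (T \<inter> Pow B \<union> T \<inter> Pow (V - B))"
    using i sp(6) T'(5) by (intro bexI[of _ i]) auto
qed

lemma tree_compose:
  assumes fin: "finite V" and E: "\<forall>e\<in>E. card e = 2"
    and B: "s \<in> B" "B \<subseteq> V - {r}" "r \<in> V" and i: "i \<in> B" "{r, i} \<in> E"
    and T: "T1 \<in> trees E B" "T2 \<in> trees E (V - B)" "T = insert {r, i} (T1 \<union> T2)"
  shows "T \<in> trees E V" "component (T \<inter> Pow (V - {r})) s = B" "T \<inter> Pow B = T1" "T \<inter> Pow (V - B) = T2"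
    "{i \<in> B. {r, i} \<in> T} = {i}"
proof -
  have T12: "T1 \<subseteq> E \<inter> Pow B" "T2 \<subseteq> E \<inter> Pow (V - B)" "conn B T1" "conn (V - B) T2"
    "card T1 + 1 = card B" "card T2 + 1 = card (V - B)" using T by (auto simp: trees_def)
  have ne: "\<exists>v. v \<in> e" if "e \<in> E" for e using that E by (intro edge_nonempty) auto
  show I: "T \<inter> Pow B = T1" "T \<inter> Pow (V - B) = T2"
    using T12 i B T(3) ne by blast+
  have "T \<inter> Pow (V - {r}) = T1 \<union> T2 \<inter> Pow (V - {r})" using T12 B T(3) by auto
  moreover have "component (T1 \<union> T2 \<inter> Pow (V - {r})) s = B"
    by (rule component_union) (use T12 B in auto)
  ultimately show "component (T \<inter> Pow (V - {r})) s = B" by simp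
  show S: "{i \<in> B. {r, i} \<in> T} = {i}"
    using T12 i B T(3) by (auto simp: doubleton_eq_iff)
  have sub: "T \<subseteq> E \<inter> Pow V" using T12 T(3) i B by auto
  have "card T = card (T \<inter> Pow B) + card (T \<inter> Pow (V - B)) + card {i \<in> B. {r, i} \<in> T}"
  proof (rule card_split[OF fin])
    show "T = T \<inter> Pow B \<union> T \<inter> Pow (V - B) \<union> (\<lambda>i. {r, i}) ` {i \<in> B. {r, i} \<in> T}"
      unfolding S I using T(3) by auto
  qed (use sub E B in auto)
  moreover have "card V = card B + card (V - B)"
    using B(2) fin by (intro card_subset_Diff) auto
  moreover have "conn V T"
    by (rule conn_compose[OF T12(3,4) i(1)]) (use B i T(3) in auto)
  ultimately show "T \<in> trees E V" using sub T12 I S by (simp add: trees_def)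
qed

lemma finite_trees: "finite V \<Longrightarrow> finite (trees E V)"
  by (rule finite_subset[of _ "Pow (Pow V)"]) (auto simp: trees_def)

text \<open>\<open>B\<close> is the branch at \<open>r\<close> that contains \<open>s\<close>, and
  \<open>i\<close> is the vertex by which it hangs on \<open>r\<close>. The vertex \<open>s\<close>
  serves to single out one branch.\<close>

lemma sum_trees_rec:
  assumes fin: "finite V" and E: "\<forall>e\<in>E. card e = 2" and rs: "r \<in> V" "s \<in> V" "r \<noteq> s"
  shows "(\<Sum>T\<in>trees E V. f T) = (\<Sum>B | s \<in> B \<and> B \<subseteq> V - {r}. \<Sum>i\<in>{i \<in> B. {r, i} \<in> E}.
    \<Sum>T1\<in>trees E B. \<Sum>T2\<in>trees E (V - B). f (insert {r, i} (T1 \<union> T2)))"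
proof -
  let ?S = "SIGMA B:{B. s \<in> B \<and> B \<subseteq> V - {r}}. {i \<in> B. {r, i} \<in> E} \<times> trees E B \<times> trees E (V - B)"
  have finB: "finite B" if "B \<subseteq> V - {r}" for B using fin that finite_subset by blast
  have "(\<Sum>T\<in>trees E V. f T) = (\<Sum>(B, i, T1, T2)\<in>?S. f (insert {r, i} (T1 \<union> T2)))"
  proof (rule sum.reindex_bij_witness[where
        i = "\<lambda>(B, i, T1, T2). insert {r, i} (T1 \<union> T2)" and
        j = "\<lambda>T. let B = component (T \<inter> Pow (V - {r})) s in
               (B, the_elem {i \<in> B. {r, i} \<in> T}, T \<inter> Pow B, T \<inter> Pow (V - B))"])
    fix T assume T: "T \<in> trees E V"
    define B where B: "B = component (T \<inter> Pow (V - {r})) s"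
    note sp = tree_split[OF fin E T rs B]
    from sp(5) obtain i where i: "i \<in> B" "{i \<in> B. {r, i} \<in> T} = {i}" "{r, i} \<in> E"
      "T = insert {r, i} (T \<inter> Pow B \<union> T \<inter> Pow (V - B))" by auto
    let ?j = "let B = component (T \<inter> Pow (V - {r})) s in
               (B, the_elem {i \<in> B. {r, i} \<in> T}, T \<inter> Pow B, T \<inter> Pow (V - B))"
    have j: "?j = (B, i, T \<inter> Pow B, T \<inter> Pow (V - B))" using i(2) by (simp flip: B)
    show "(case ?j of (B, i, T1, T2) \<Rightarrow> insert {r, i} (T1 \<union> T2)) = T"
      unfolding j using i(4) by simp
    then show "(case ?j of (B, i, T1, T2) \<Rightarrow> f (insert {r, i} (T1 \<union> T2))) = f T"
      unfolding j by simp
    show "?j \<in> ?S" unfolding j using sp i by auto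
  next
    fix b assume "b \<in> ?S"
    then obtain B i T1 T2 where b: "b = (B, i, T1, T2)" "s \<in> B" "B \<subseteq> V - {r}" "i \<in> B" "{r, i} \<in> E"
      "T1 \<in> trees E B" "T2 \<in> trees E (V - B)" by auto
    note co = tree_compose[OF fin E b(2,3) rs(1) b(4-7) refl]
    show "(\<lambda>T. let B = component (T \<inter> Pow (V - {r})) s in
               (B, the_elem {i \<in> B. {r, i} \<in> T}, T \<inter> Pow B, T \<inter> Pow (V - B)))
        (case b of (B, i, T1, T2) \<Rightarrow> insert {r, i} (T1 \<union> T2)) = b"
      unfolding b(1) prod.case Let_def co by simp
    show "(case b of (B, i, T1, T2) \<Rightarrow> insert {r, i} (T1 \<union> T2)) \<in> trees E V"
      using co b by simp
  qed
  also have "\<dots> = (\<Sum>B | s \<in> B \<and> B \<subseteq> V - {r}. \<Sum>(i, T1, T2)\<in>{i \<in> B. {r, i} \<in> E} \<times> trees E B \<times> trees E (V - B).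
      f (insert {r, i} (T1 \<union> T2)))"
    by (subst sum.Sigma)
       (use fin finB in \<open>auto simp: split_def intro!: finite_cartesian_product finite_trees\<close>)
  also have "\<dots> = (\<Sum>B | s \<in> B \<and> B \<subseteq> V - {r}. \<Sum>i\<in>{i \<in> B. {r, i} \<in> E}.
    \<Sum>T1\<in>trees E B. \<Sum>T2\<in>trees E (V - B). f (insert {r, i} (T1 \<union> T2)))"
    by (simp add: sum.cartesian_product)
  finally show ?thesis .
qed

subsection \<open>Spanning trees and paths\<close>

lemma reach_imp_path:
  assumes "(u, v) \<in> (adj A)\<^sup>*"
  shows "\<exists>p. is_path A u p v"
  using assms
proof induction
  case base
  show ?case by (rule exI[of _ "[u]"]) (simp add: is_path_def)
next
  case (step y z)
  then obtain p where p: "is_path A u p y" by auto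
  have e: "{y, z} \<in> A" using step by (simp add: adj_def)
  show ?case
  proof (cases "z \<in> set p")
    case True
    then obtain ys zs where "p = ys @ z # zs" by (meson split_list)
    then have eq: "p = (ys @ [z]) @ zs" by simp
    have "successively (\<lambda>x y. {x, y} \<in> A) (ys @ [z])" "distinct (ys @ [z])"
      using p unfolding eq is_path_def successively_append_iff distinct_append by blast+
    moreover have "hd (ys @ [z]) = u" using p eq by (cases ys) (auto simp: is_path_def)
    ultimately have "is_path A u (ys @ [z]) z" by (simp add: is_path_def)
    then show ?thesis by auto
  next
    case False
    then have "is_path A u (p @ [z]) z"
      using p e by (auto simp: is_path_def successively_append_iff)
    then show ?thesis by auto
  qed
qed

lemma successively_reach:
  assumes "successively (\<lambda>x y. {x, y} \<in> A) p" "p \<noteq> []"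
  shows "(hd p, last p) \<in> (adj A)\<^sup>*"
  using assms
proof (induction p)
  case (Cons x p)
  show ?case
  proof (cases p)
    case (Cons y p')
    then have "(x, y) \<in> adj A" "(y, last p) \<in> (adj A)\<^sup>*"
      using Cons.IH Cons.prems by (auto simp: adj_def)
    then show ?thesis using Cons by (auto intro: converse_rtrancl_into_rtrancl)
  qed simp
qed simp

lemma ex_path_iff: "(\<exists>p. is_path A u p v) \<longleftrightarrow> (u, v) \<in> (adj A)\<^sup>*"
  using reach_imp_path successively_reach by (metis is_path_def)

lemma connected_graph_iff: "connected_graph V A \<longleftrightarrow> conn V A"
  by (simp add: connected_graph_def conn_def ex_path_iff)

lemma is_path_set:
  assumes "is_path A u p v" "A \<subseteq> Pow B" "u \<in> B"
  shows "set p \<subseteq> B"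
proof -
  have "set p \<subseteq> B" if "successively (\<lambda>x y. {x, y} \<in> A) p" "p \<noteq> [] \<Longrightarrow> hd p \<in> B" for p
    using that
  proof (induction p)
    case (Cons x p)
    then show ?case using assms(2) by (cases p) auto
  qed simp
  then show ?thesis using assms by (auto simp: is_path_def)
qed

lemma is_path_mono: "is_path A u p v \<Longrightarrow> A \<subseteq> A' \<Longrightarrow> is_path A' u p v"
  unfolding is_path_def by (auto elim: successively_mono)

text \<open>Two edges from \<open>r\<close> into the connected set \<open>B\<close> would close a
  cycle through \<open>r\<close>, so there is exactly one and the counts of
  \<open>conn_split\<close> add up.\<close>

lemma acyclic_imp_card:
  assumes "finite V" "V \<noteq> {}" "T \<subseteq> Pow V" "\<forall>e\<in>T. card e = 2" "conn V T" "acyclic_graph T"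
  shows "card T + 1 = card V"
  using assms
proof (induction V arbitrary: T rule: finite_psubset_induct)
  case (psubset V)
  show ?case
  proof (cases "\<exists>r s. r \<in> V \<and> s \<in> V \<and> r \<noteq> s")
    case False
    then obtain v where V: "V = {v}" using psubset.prems(1) by auto
    then have "T = {}" using psubset.prems(2,3) by (force simp: subset_singleton_iff)
    then show ?thesis using V by simp
  next
    case True
    then obtain r s where rs: "r \<in> V" "s \<in> V" "r \<noteq> s" by auto
    define B where B: "B = component (T \<inter> Pow (V - {r})) s"
    note sp = conn_split[OF psubset.prems(2-4) rs B]
    have acy: "acyclic_graph T'" if "T' \<subseteq> T" for T'
      using psubset.prems(5) is_path_mono[OF _ that] that unfolding acyclic_graph_def
      by (meson subsetD)
    obtain i where i: "i \<in> B" "{r, i} \<in> T" using sp(5) by auto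
    have "j = i" if j: "j \<in> B" "{r, j} \<in> T" for j
    proof (rule ccontr)
      assume "j \<noteq> i"
      have "(i, j) \<in> (adj (T \<inter> Pow B))\<^sup>*" using sp(3) i j by (simp add: conn_def)
      then obtain p where p: "is_path (T \<inter> Pow B) i p j" using reach_imp_path[of i j "T \<inter> Pow B"] by blast
      have "set p \<subseteq> B" by (rule is_path_set[OF p]) (use i in auto)
      then have "r \<notin> set p" using sp(2) by auto
      moreover have p': "is_path T i p j" using p by (rule is_path_mono) auto
      ultimately have "is_path T r (r # p) j"
        using i by (cases p) (auto simp: is_path_def)
      moreover have "length p \<ge> 2" using p' \<open>j \<noteq> i\<close>
        by (cases p; cases "tl p") (auto simp: is_path_def)
      then have "length (r # p) \<ge> 3" by simp
      moreover have "{j, r} \<in> T" using j by (simp add: insert_commute)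
      ultimately show False
        using psubset.prems(5) unfolding acyclic_graph_def by blast
    qed
    then have S: "{i \<in> B. {r, i} \<in> T} = {i}" using i by blast
    have "card (T \<inter> Pow B) + 1 = card B"
      by (rule psubset.IH) (use sp(1-5) rs psubset.prems acy in auto)
    moreover have "card (T \<inter> Pow (V - B)) + 1 = card (V - B)"
      by (rule psubset.IH) (use sp(1-5) rs psubset.prems acy in auto)
    moreover have "card V = card B + card (V - B)"
      using sp(2) psubset.hyps by (intro card_subset_Diff) auto
    ultimately show ?thesis
      using card_split[OF psubset.hyps(1) psubset.prems(2,3) sp(2,6)] S by simp
  qed
qed

text \<open>Removing the closing edge of a cycle keeps \<open>V\<close> connected but leaves fewer
  edges than \<open>card_conn\<close> allows.\<close>

lemma card_imp_acyclic:
  assumes "finite V" "T \<subseteq> Pow V" "\<forall>e\<in>T. card e = 2" "conn V T" "card T + 1 = card V"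
  shows "acyclic_graph T"
  unfolding acyclic_graph_def
proof
  assume "\<exists>u p v. is_path T u p v \<and> length p \<ge> 3 \<and> {v, u} \<in> T"
  then obtain u p v where p: "is_path T u p v" "length p \<ge> 3" "{v, u} \<in> T" by auto
  let ?T = "T - {{v, u}}"
  \<comment> \<open>The closing edge is not a step of the path: its ends sit at positions 0 and
    \<open>length p - 1\<close>, which is at least 2, in a distinct list.\<close>
  have "successively (\<lambda>x y. {x, y} \<in> ?T) p"
    unfolding successively_conv_nth
  proof safe
    fix k assume k: "Suc k < length p"
    then show "{p ! k, p ! Suc k} \<in> T" using p by (simp add: is_path_def successively_conv_nth)
    assume "{p ! k, p ! Suc k} = {v, u}"
    moreover have "u = p ! 0" "v = p ! (length p - 1)" "distinct p" "p \<noteq> []"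
      using p by (auto simp: is_path_def hd_conv_nth last_conv_nth)
    ultimately show False
      using k p(2) by (auto simp: doubleton_eq_iff nth_eq_iff_index_eq)
  qed
  then have r: "(u, v) \<in> (adj ?T)\<^sup>*"
    using successively_reach[of ?T p] p by (auto simp: is_path_def)
  have "(adj T)\<^sup>* \<subseteq> (adj ?T)\<^sup>*"
  proof -
    have "(x, y) \<in> (adj ?T)\<^sup>*" if "(x, y) \<in> adj T" for x y
      using that r adj_sym[OF r] by (cases "{x, y} = {v, u}") (auto simp: adj_def doubleton_eq_iff)
    then show ?thesis by (simp add: rtrancl_subset_rtrancl subrelI)
  qed
  then have "conn V ?T" using assms(4) by (auto simp: conn_def)
  moreover have "V \<noteq> {}" using assms(5) by auto
  ultimately have "card V \<le> card ?T + 1" using assms by (intro card_conn) auto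
  moreover have "card ?T < card T"
    using p(3) finite_edges[OF assms(1,2)] by (intro psubset_card_mono) auto
  ultimately show False using assms(5) by simp
qed

lemma spanning_trees_eq:
  assumes "finite V" "V \<noteq> {}" "\<forall>e\<in>E. card e = 2" "E \<subseteq> Pow V"
  shows "spanning_trees V E = trees E V"
proof -
  have "acyclic_graph T \<longleftrightarrow> card T + 1 = card V" if "T \<subseteq> E" "conn V T" for T
  proof -
    have T: "T \<subseteq> Pow V" "\<forall>e\<in>T. card e = 2" using that assms by auto
    show ?thesis
      using acyclic_imp_card[OF assms(1,2) T that(2)] card_imp_acyclic[OF assms(1) T that(2)] by blast
  qed
  then show ?thesis using assms(4) unfolding spanning_trees_def trees_def connected_graph_iff by blast
qed

text \<open>\<open>tree_path\<close> with a variable root: the branch \<open>B\<close> is rooted at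
  its attaching vertex.\<close>

definition root_path :: "'v set set \<Rightarrow> 'v \<Rightarrow> 'v \<Rightarrow> 'v list" where
  "root_path T r v = (THE p. is_path T r p v)"

text \<open>\<open>{r, i}\<close> is the only edge between \<open>B\<close> and the rest, and a path
  that starts at \<open>r\<close> never returns to \<open>r\<close>. So it either enters
  \<open>B\<close> in its first step and stays there, or avoids \<open>B\<close>.\<close>

lemma is_path_tree_compose:
  assumes B: "B \<subseteq> V - {r}" "r \<in> V" and i: "i \<in> B"
    and T1: "T1 \<subseteq> Pow B" and T2: "T2 \<subseteq> Pow (V - B)" and T: "T = insert {r, i} (T1 \<union> T2)"
  shows "v \<in> B \<Longrightarrow> is_path T r p v \<longleftrightarrow> (\<exists>p'. p = r # p' \<and> is_path T1 i p' v)"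
    and "v \<in> V - B \<Longrightarrow> is_path T r p v \<longleftrightarrow> is_path T2 r p v"
proof -
  have inB: "successively (\<lambda>x y. {x, y} \<in> T1) p \<and> set p \<subseteq> B"
    if "successively (\<lambda>x y. {x, y} \<in> T) p" "r \<notin> set p" "p \<noteq> []" "hd p \<in> B" for p
    using that
  proof (induction p)
    case (Cons x p)
    show ?case
    proof (cases p)
      case (Cons y p')
      then have "{x, y} \<in> T1" using Cons.prems T T2 by (auto simp: doubleton_eq_iff)
      then show ?thesis using Cons.IH Cons.prems Cons T1 by auto
    qed (use Cons.prems in simp)
  qed simp
  have outB: "successively (\<lambda>x y. {x, y} \<in> T2) p \<and> set p \<subseteq> V - B"
    if "successively (\<lambda>x y. {x, y} \<in> T) p" "r \<notin> set p" "p \<noteq> []" "hd p \<in> V - B" for p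
    using that
  proof (induction p)
    case (Cons x p)
    show ?case
    proof (cases p)
      case (Cons y p')
      then have "{x, y} \<in> T2" using Cons.prems T T1 by (auto simp: doubleton_eq_iff)
      then show ?thesis using Cons.IH Cons.prems Cons T2 by auto
    qed (use Cons.prems in simp)
  qed simp
  have sub: "T1 \<subseteq> T" "T2 \<subseteq> T" "{r, i} \<in> T" using T by auto
  have second: "(y = i \<and> y \<in> B) \<or> (y \<in> V - B \<and> {r, y} \<in> T2)" if "{r, y} \<in> T" for y
    using that T T1 T2 B i by (auto simp: doubleton_eq_iff)
  show "is_path T r p v \<longleftrightarrow> (\<exists>p'. p = r # p' \<and> is_path T1 i p' v)" if v: "v \<in> B"
  proof
    assume p: "is_path T r p v"
    then obtain p' where p': "p = r # p'" by (cases p) (auto simp: is_path_def)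
    have "p' \<noteq> []" using p p' v B by (auto simp: is_path_def)
    then have f: "successively (\<lambda>x y. {x, y} \<in> T) p'" "r \<notin> set p'" "{r, hd p'} \<in> T" "last p' = v" "distinct p'"
      using p p' by (cases p'; auto simp: is_path_def)+
    have "hd p' \<notin> V - B"
    proof
      assume "hd p' \<in> V - B"
      then have "set p' \<subseteq> V - B" using outB[OF f(1,2) \<open>p' \<noteq> []\<close>] by auto
      then show False using f(4) \<open>p' \<noteq> []\<close> v last_in_set by fastforce
    qed
    then have "hd p' = i" using second[OF f(3)] by auto
    then have "is_path T1 i p' v" using inB[OF f(1,2) \<open>p' \<noteq> []\<close>] f i \<open>p' \<noteq> []\<close> by (simp add: is_path_def)
    then show "\<exists>p'. p = r # p' \<and> is_path T1 i p' v" using p' by auto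
  next
    assume "\<exists>p'. p = r # p' \<and> is_path T1 i p' v"
    then obtain p' where p': "p = r # p'" "is_path T1 i p' v" by auto
    have "set p' \<subseteq> B" using is_path_set[OF p'(2) T1 i] .
    then have "r \<notin> set p'" using B by auto
    then show "is_path T r p v"
      using is_path_mono[OF p'(2) sub(1)] sub(3) p'(1) by (cases p') (auto simp: is_path_def)
  qed
  show "is_path T r p v \<longleftrightarrow> is_path T2 r p v" if v: "v \<in> V - B"
  proof
    assume p: "is_path T r p v"
    then obtain p' where p': "p = r # p'" by (cases p) (auto simp: is_path_def)
    show "is_path T2 r p v"
    proof (cases "p' = []")
      case True
      then show ?thesis using p p' by (auto simp: is_path_def)
    next
      case False
      then have f: "successively (\<lambda>x y. {x, y} \<in> T) p'" "r \<notin> set p'" "{r, hd p'} \<in> T" "last p' = v" "distinct p'"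
        using p p' by (cases p'; auto simp: is_path_def)+
      have "hd p' \<notin> B"
      proof
        assume "hd p' \<in> B"
        then have "set p' \<subseteq> B" using inB[OF f(1,2) False] by auto
        then show False using f(4) False v last_in_set by fastforce
      qed
      then have h: "hd p' \<in> V - B" "{r, hd p'} \<in> T2" using second[OF f(3)] by auto
      then show ?thesis using outB[OF f(1,2) False h(1)] f p' False
        by (cases p') (auto simp: is_path_def)
    qed
  next
    assume "is_path T2 r p v"
    then show "is_path T r p v" using sub(2) by (rule is_path_mono)
  qed
qed

lemma tree_singleton: 
  assumes "\<forall>e\<in>E. card e = 2" shows "trees E {v} = {{}}"
proof -
  have "E \<inter> Pow {v} = {}" using assms by (force simp: subset_singleton_iff)
  then show ?thesis by (auto simp: trees_def conn_def)
qed

lemma tree_unique_path: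
  assumes "finite V" "\<forall>e\<in>E. card e = 2" "T \<in> trees E V" "r \<in> V" "v \<in> V"
  shows "\<exists>!p. is_path T r p v"
  using assms(1,3-5)
proof (induction V arbitrary: T r v rule: finite_psubset_induct)
  case (psubset V)
  show ?case
  proof (cases "\<exists>s. s \<in> V \<and> r \<noteq> s")
    case False
    then have V: "V = {r}" "v = r" using psubset.prems by auto
    then have "T = {}" using tree_singleton[OF assms(2)] psubset.prems by auto
    have "is_path {} r p r \<longleftrightarrow> p = [r]" for p
      by (cases p; cases "tl p") (auto simp: is_path_def)
    then show ?thesis using V \<open>T = {}\<close> by simp
  next
    case True
    then obtain s where rs: "s \<in> V" "r \<noteq> s" by auto
    define B where B: "B = component (T \<inter> Pow (V - {r})) s"
    note sp = tree_split[OF psubset.hyps(1) assms(2) psubset.prems(1,2) rs B]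
    from sp(5) obtain i where i: "i \<in> B" "T = insert {r, i} (T \<inter> Pow B \<union> T \<inter> Pow (V - B))" by auto
    note ip = is_path_tree_compose[OF sp(2) psubset.prems(2) i(1) _ _ i(2)]
    show ?thesis
    proof (cases "v \<in> B")
      case True
      then have "\<exists>!p. is_path (T \<inter> Pow B) i p v"
        using sp(2,3) i(1) psubset.prems True by (intro psubset.IH[of B]) auto
      moreover have "is_path T r p v \<longleftrightarrow> (\<exists>p'. p = r # p' \<and> is_path (T \<inter> Pow B) i p' v)" for p
        using ip(1)[OF _ _ True] by blast
      ultimately show ?thesis by auto
    next
      case False
      then have "\<exists>!p. is_path (T \<inter> Pow (V - B)) r p v"
        using sp(1,2,4) rs psubset.prems False by (intro psubset.IH[of "V - B"]) auto
      moreover have "is_path T r p v = is_path (T \<inter> Pow (V - B)) r p v" for p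
        using ip(2)[of v] False psubset.prems by blast
      ultimately show ?thesis by simp
    qed
  qed
qed

lemma root_path_is_path:
  assumes "finite V" "\<forall>e\<in>E. card e = 2" "T \<in> trees E V" "r \<in> V" "v \<in> V"
  shows "is_path T r (root_path T r v) v"
  unfolding root_path_def using tree_unique_path[OF assms] by (rule theI')

lemma root_path_eqI:
  assumes "finite V" "\<forall>e\<in>E. card e = 2" "T \<in> trees E V" "r \<in> V" "v \<in> V" "is_path T r p v"
  shows "root_path T r v = p"
  using root_path_is_path[OF assms(1-5)] tree_unique_path[OF assms(1-5)] assms(6) by auto

lemma root_path_compose:
  assumes fin: "finite V" and E: "\<forall>e\<in>E. card e = 2"
    and B: "B \<subseteq> V - {r}" "r \<in> V" and i: "i \<in> B" "{r, i} \<in> E"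
    and T: "T1 \<in> trees E B" "T2 \<in> trees E (V - B)" "T = insert {r, i} (T1 \<union> T2)"
  shows "v \<in> B \<Longrightarrow> root_path T r v = r # root_path T1 i v"
    and "v \<in> V - B \<Longrightarrow> root_path T r v = root_path T2 r v"
proof -
  have TV: "T \<in> trees E V" by (rule tree_compose(1)[OF fin E i(1) B i T])
  have s: "T1 \<subseteq> Pow B" "T2 \<subseteq> Pow (V - B)" using T by (auto simp: trees_def)
  have finB: "finite B" using B fin finite_subset by blast
  note ip = is_path_tree_compose[OF B i(1) s T(3)]
  show "root_path T r v = r # root_path T1 i v" if v: "v \<in> B"
    by (rule root_path_eqI[OF fin E TV B(2)])
       (use v B ip(1)[OF v] root_path_is_path[OF finB E T(1) i(1) v] in auto)
  show "root_path T r v = root_path T2 r v" if v: "v \<in> V - B"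
    by (rule root_path_eqI[OF fin E TV B(2)])
       (use v B ip(2)[OF v] root_path_is_path[OF _ E T(2) _ v] fin in auto)
qed

subsection \<open>The inversion weight of rooted trees\<close>

text \<open>The root is excluded as first component, whatever its label; for \<open>r = 0\<close>
  this is the condition in \<open>Inv\<close>.\<close>

definition rooted_inv :: "nat set \<Rightarrow> nat \<Rightarrow> nat set set \<Rightarrow> (nat \<times> nat) set" where
  "rooted_inv V r T = {(i, j). i \<in> V \<and> j \<in> V \<and> i \<noteq> r \<and> i > j \<and> i \<in> set (root_path T r j)}"

text \<open>At the root the value is \<open>last []\<close>; the clause \<open>i \<noteq> r\<close>
  of \<open>rooted_inv\<close> keeps it out of \<open>rooted_weight\<close>.\<close>

definition rooted_parent :: "nat set set \<Rightarrow> nat \<Rightarrow> nat \<Rightarrow> nat" where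
  "rooted_parent T r i = last (butlast (root_path T r i))"

definition rooted_weight :: "nat set \<Rightarrow> (nat \<Rightarrow> nat) \<Rightarrow> 'a::comm_ring_1 \<Rightarrow> nat \<Rightarrow> nat set set \<Rightarrow> 'a" where
  "rooted_weight V a q r T = (\<Prod>e\<in>T. q_int q (a (Max e)))
     * (\<Prod>(i, j)\<in>rooted_inv V r T. q ^ a (max (rooted_parent T r i) j))"

lemma Max_pair: "Max {x, y :: nat} = max x y"
  by simp

text \<open>The inversions of \<open>T\<close> are those of the two parts and new ones
  \<open>(i, j)\<close> with \<open>j < i\<close> in \<open>B\<close>: \<open>i\<close> is an
  ancestor of all of \<open>B\<close>, but as the root of \<open>T1\<close> it was not counted
  there. Its parent in \<open>T\<close> is \<open>r\<close>, which gives the factors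
  \<open>q ^ a (max r j)\<close>.\<close>

lemma rooted_weight_compose:
  assumes fin: "finite V" and E: "\<forall>e\<in>E. card e = 2"
    and B: "B \<subseteq> V - {r}" "r \<in> V" and i: "i \<in> B" "{r, i} \<in> E"
    and T: "T1 \<in> trees E B" "T2 \<in> trees E (V - B)" "T = insert {r, i} (T1 \<union> T2)"
  shows "rooted_weight V a q r T =
    q_int q (a (max r i)) * (\<Prod>j\<in>{j \<in> B. j < i}. q ^ a (max r j)) *
    rooted_weight B a q i T1 * rooted_weight (V - B) a q r T2"
proof -
  have s: "T1 \<subseteq> E \<inter> Pow B" "T2 \<subseteq> E \<inter> Pow (V - B)" using T by (auto simp: trees_def)
  have finB: "finite B" using B fin finite_subset by blast
  have finT: "finite T1" "finite T2" using s finB fin by (meson finite_Diff finite_edges le_inf_iff)+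
  note rp = root_path_compose[OF fin E B i T]
  have P1: "is_path T1 i (root_path T1 i v) v" if "v \<in> B" for v
    using root_path_is_path[OF finB E T(1) i(1) that] .
  have P2: "is_path T2 r (root_path T2 r v) v" if "v \<in> V - B" for v
    by (rule root_path_is_path[OF _ E T(2) _ that]) (use fin B in auto)
  have S1: "set (root_path T1 i v) \<subseteq> B" if "v \<in> B" for v
    by (rule is_path_set[OF P1[OF that]]) (use s i in auto)
  have S2: "set (root_path T2 r v) \<subseteq> V - B" if "v \<in> V - B" for v
    by (rule is_path_set[OF P2[OF that]]) (use s B in auto)
  have hd1: "i \<in> set (root_path T1 i v)" if "v \<in> B" for v
    using P1[OF that] by (metis is_path_def list.set_sel(1))
  have "root_path T1 i i = [i]"
    by (rule root_path_eqI[OF finB E T(1) i(1) i(1)]) (simp add: is_path_def)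
  then have par_i: "rooted_parent T r i = r" using rp(1)[OF i(1)] by (simp add: rooted_parent_def)
  \<comment> \<open>For \<open>k \<noteq> i\<close> the path within \<open>T1\<close> has at least
    two vertices, so prefixing \<open>r\<close> does not change the last but one.\<close>
  have par1: "rooted_parent T r k = rooted_parent T1 i k" if k: "k \<in> B" "k \<noteq> i" for k
  proof -
    let ?p = "root_path T1 i k"
    have "butlast ?p \<noteq> []" using P1[OF k(1)] k(2) by (cases ?p; cases "tl ?p") (auto simp: is_path_def)
    moreover have "?p \<noteq> []" using P1[OF k(1)] by (simp add: is_path_def)
    ultimately show ?thesis using rp(1)[OF k(1)] by (simp add: rooted_parent_def)
  qed
  have par2: "rooted_parent T r k = rooted_parent T2 r k" if "k \<in> V - B" for k
    using rp(2)[OF that] by (simp add: rooted_parent_def)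
  let ?I = "(\<lambda>j. (i, j)) ` {j \<in> B. j < i}"
  have inv: "rooted_inv V r T = ?I \<union> rooted_inv B i T1 \<union> rooted_inv (V - B) r T2" (is "?l = ?r")
  proof (intro equalityI subsetI)
    fix p assume p: "p \<in> ?l"
    then obtain k j where kj: "p = (k, j)" "k \<in> V" "j \<in> V" "k \<noteq> r" "k > j" "k \<in> set (root_path T r j)"
      by (auto simp: rooted_inv_def)
    show "p \<in> ?r"
    proof (cases "j \<in> B")
      case True
      then have "k \<in> set (root_path T1 i j)" using kj rp(1) by auto
      then show ?thesis using kj S1[OF True] True by (auto simp: rooted_inv_def)
    next
      case False
      then have "k \<in> set (root_path T2 r j)" using kj rp(2) by auto
      then show ?thesis using kj S2[of j] False by (auto simp: rooted_inv_def)
    qed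
  next
    fix p assume "p \<in> ?r"
    then consider "p \<in> ?I" | "p \<in> rooted_inv B i T1" | "p \<in> rooted_inv (V - B) r T2" by auto
    then show "p \<in> ?l"
    proof cases
      case 1
      then show ?thesis using B i hd1 rp(1) by (auto simp: rooted_inv_def)
    next
      case 2
      then show ?thesis using B rp(1) by (auto simp: rooted_inv_def)
    next
      case 3
      then show ?thesis using B rp(2) by (auto simp: rooted_inv_def)
    qed
  qed
  have fI: "finite (rooted_inv W r' T')" if "finite W" for W r' T'
    by (rule finite_subset[of _ "W \<times> W"]) (use that in \<open>auto simp: rooted_inv_def\<close>)
  let ?f = "\<lambda>(k, j). q ^ a (max (rooted_parent T r k) j)"
  have "(\<Prod>p\<in>rooted_inv V r T. ?f p) = (\<Prod>p\<in>?I. ?f p) * (\<Prod>p\<in>rooted_inv B i T1. ?f p)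
      * (\<Prod>p\<in>rooted_inv (V - B) r T2. ?f p)"
  proof -
    have "?I \<inter> rooted_inv B i T1 = {}" by (auto simp: rooted_inv_def)
    moreover have "(?I \<union> rooted_inv B i T1) \<inter> rooted_inv (V - B) r T2 = {}"
      using i by (auto simp: rooted_inv_def)
    ultimately show ?thesis
      unfolding inv using fI finB fin by (simp add: prod.union_disjoint)
  qed
  also have "(\<Prod>p\<in>?I. ?f p) = (\<Prod>j\<in>{j \<in> B. j < i}. q ^ a (max r j))"
    by (subst prod.reindex) (auto simp: inj_on_def par_i)
  also have "(\<Prod>p\<in>rooted_inv B i T1. ?f p) = (\<Prod>(k, j)\<in>rooted_inv B i T1. q ^ a (max (rooted_parent T1 i k) j))"
    by (rule prod.cong) (auto simp: rooted_inv_def par1)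
  also have "(\<Prod>p\<in>rooted_inv (V - B) r T2. ?f p) = (\<Prod>(k, j)\<in>rooted_inv (V - B) r T2. q ^ a (max (rooted_parent T2 r k) j))"
    by (rule prod.cong) (auto simp: rooted_inv_def par2)
  finally have invp: "(\<Prod>p\<in>rooted_inv V r T. ?f p) = (\<Prod>j\<in>{j \<in> B. j < i}. q ^ a (max r j))
    * (\<Prod>(k, j)\<in>rooted_inv B i T1. q ^ a (max (rooted_parent T1 i k) j))
    * (\<Prod>(k, j)\<in>rooted_inv (V - B) r T2. q ^ a (max (rooted_parent T2 r k) j))" .
  have "{r, i} \<notin> T1 \<union> T2" using s B i by auto
  moreover have "T1 \<inter> T2 = {}"
  proof -
    have "\<exists>v. v \<in> e" if "e \<in> E" for e using that E by (intro edge_nonempty) auto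
    then show ?thesis using s by blast
  qed
  ultimately have "(\<Prod>e\<in>T. q_int q (a (Max e))) =
      q_int q (a (max r i)) * (\<Prod>e\<in>T1. q_int q (a (Max e))) * (\<Prod>e\<in>T2. q_int q (a (Max e)))"
    unfolding T(3) using finT by (simp add: prod.union_disjoint mult.assoc)
  then show ?thesis unfolding rooted_weight_def invp by (simp add: mult_ac)
qed

lemma q_int_mult: "(q - 1) * q_int q k = q ^ k - (1 :: 'a::comm_ring_1)"
  unfolding q_int_def by (induction k) (simp_all add: algebra_simps)

text \<open>
  The independence of the root \<open>r\<close> is what makes the induction work: the component \<open>B\<close> inherits as
  its root the neighbour of \<open>r\<close>, which can be any vertex of \<open>B\<close>.
\<close>

lemma sum_rooted_weight:
  fixes q :: "'a::comm_ring_1"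
  assumes E: "\<forall>e\<in>E. card e = 2" and sh: "shifted E" and "finite V" "r \<in> V"
  shows "(q - 1) ^ (card V - 1) * (\<Sum>T\<in>trees E V. rooted_weight V a q r T)
    = conn_poly E (max_wt q a) V"
  using assms(3,4)
proof (induction V arbitrary: r rule: finite_psubset_induct)
  case (psubset V)
  note fin = \<open>finite V\<close>
  let ?D = "conn_poly E (max_wt q a)"
  let ?W = "\<lambda>V r. \<Sum>T\<in>trees E V. rooted_weight V a q r T"
  show ?case
  proof (cases "\<exists>s. s \<in> V \<and> r \<noteq> s")
    case False
    then have V: "V = {r}" using psubset.prems by blast
    have "rooted_inv {r} r {} = {}" by (auto simp: rooted_inv_def)
    then show ?thesis
      unfolding V tree_singleton[OF E] conn_poly_singleton[OF E] by (simp add: rooted_weight_def)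
  next
    case True
    then obtain s where s: "s \<in> V" "r \<noteq> s" by auto
    have "(q - 1) ^ (card V - 1) * ?W V r = (\<Sum>B | s \<in> B \<and> B \<subseteq> V - {r}. (q - 1) ^ (card V - 1) *
      (\<Sum>i\<in>{i \<in> B. {r, i} \<in> E}. \<Sum>T1\<in>trees E B. \<Sum>T2\<in>trees E (V - B).
       rooted_weight V a q r (insert {r, i} (T1 \<union> T2))))"
      by (subst sum_trees_rec[OF fin E psubset.prems s]) (rule sum_distrib_left)
    also have "\<dots> = (\<Sum>B | s \<in> B \<and> B \<subseteq> V - {r}. (star_prod E (max_wt q a) r B - 1) * ?D B * ?D (V - B))"
    proof (rule sum.cong)
      fix B assume "B \<in> {B. s \<in> B \<and> B \<subseteq> V - {r}}"
      then have B: "s \<in> B" "B \<subseteq> V - {r}" by auto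
      have finB: "finite B" using B fin finite_subset by blast
      let ?N = "{i \<in> B. {r, i} \<in> E}"
      let ?c = "\<lambda>i. \<Prod>j\<in>{j \<in> B. j < i}. q ^ a (max r j)"
      have cV: "card V = card B + card (V - B)"
        using B fin by (intro card_subset_Diff) auto
      \<comment> \<open>Both parts are nonempty, so no subtraction truncates: one factor
        \<open>q - 1\<close> goes to the edge \<open>{r, i}\<close>, the others to the two
        subtrees.\<close>
      have "card B \<noteq> 0" "card (V - B) \<noteq> 0" using B finB fin psubset.prems by auto
      then have cV': "card V - 1 = 1 + (card B - 1) + (card (V - B) - 1)" using cV by simp
      have DC: "(q - 1) ^ (card (V - B) - 1) * ?W (V - B) r = ?D (V - B)"
        by (rule psubset.IH) (use B s psubset.prems in auto)
      have DB: "(q - 1) ^ (card B - 1) * ?W B i = ?D B" if "i \<in> B" for i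
        by (rule psubset.IH) (use B that psubset.prems in auto)
      have "(q - 1) ^ (card V - 1) * (\<Sum>i\<in>?N. \<Sum>T1\<in>trees E B. \<Sum>T2\<in>trees E (V - B).
         rooted_weight V a q r (insert {r, i} (T1 \<union> T2)))
        = (q - 1) ^ (card V - 1) * (\<Sum>i\<in>?N. q_int q (a (max r i)) * ?c i * (?W B i * ?W (V - B) r))"
      proof (intro arg_cong2[of _ _ _ _ "(*)"] sum.cong refl)
        fix i assume i: "i \<in> ?N"
        have "(\<Sum>T1\<in>trees E B. \<Sum>T2\<in>trees E (V - B). rooted_weight V a q r (insert {r, i} (T1 \<union> T2)))
          = (\<Sum>T1\<in>trees E B. \<Sum>T2\<in>trees E (V - B). q_int q (a (max r i)) * ?c i *
               (rooted_weight B a q i T1 * rooted_weight (V - B) a q r T2))"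
          using i rooted_weight_compose[OF fin E B(2) psubset.prems, of i _ _ _ a q]
          by (intro sum.cong refl) (simp add: mult.assoc)
        then show "(\<Sum>T1\<in>trees E B. \<Sum>T2\<in>trees E (V - B). rooted_weight V a q r (insert {r, i} (T1 \<union> T2)))
          = q_int q (a (max r i)) * ?c i * (?W B i * ?W (V - B) r)"
          by (simp only: sum_distrib_left[symmetric] sum_product)
      qed
      also have "\<dots> = (\<Sum>i\<in>?N. ((q - 1) * q_int q (a (max r i))) * ?c i *
          (((q - 1) ^ (card B - 1) * ?W B i) * ((q - 1) ^ (card (V - B) - 1) * ?W (V - B) r)))"
        unfolding cV' power_add by (subst sum_distrib_left, rule sum.cong) (simp_all add: mult_ac)
      also have "\<dots> = (\<Sum>i\<in>?N. (max_wt q a {r, i} - 1) * (\<Prod>j\<in>{j \<in> ?N. j < i}. max_wt q a {r, j}) * (?D B * ?D (V - B)))"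
      proof (rule sum.cong)
        fix i assume i: "i \<in> ?N"
        \<comment> \<open>Inversions run over all \<open>j < i\<close> in \<open>B\<close>, the
          telescoping sum only over neighbours of \<open>r\<close>; shiftedness identifies the
          two.\<close>
        have "{r, j} \<in> E" if "j \<in> B" "j < i" for j
        proof -
          have "r \<noteq> j" "{i, r} \<in> E" using B that i by (auto simp: insert_commute)
          then have "{j, r} \<in> E" using sh that unfolding shifted_def by metis
          then show ?thesis by (simp add: insert_commute)
        qed
        then have N: "{j \<in> ?N. j < i} = {j \<in> B. j < i}" by auto
        have iB: "i \<in> B" using i by simp
        show "((q - 1) * q_int q (a (max r i))) * ?c i *
          (((q - 1) ^ (card B - 1) * ?W B i) * ((q - 1) ^ (card (V - B) - 1) * ?W (V - B) r))
          = (max_wt q a {r, i} - 1) * (\<Prod>j\<in>{j \<in> ?N. j < i}. max_wt q a {r, j}) * (?D B * ?D (V - B))"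
          unfolding N DB[OF iB] DC q_int_mult Max_pair ..
      qed simp
      also have "\<dots> = (star_prod E (max_wt q a) r B - 1) * ?D B * ?D (V - B)"
        unfolding sum_distrib_right[symmetric] star_prod_def
        by (subst telescope_initial[of ?N "\<lambda>i. max_wt q a {r, i}"]) (use finB in \<open>auto simp: mult.assoc\<close>)
      finally show "(q - 1) ^ (card V - 1) * (\<Sum>i\<in>?N. \<Sum>T1\<in>trees E B. \<Sum>T2\<in>trees E (V - B).
         rooted_weight V a q r (insert {r, i} (T1 \<union> T2)))
        = (star_prod E (max_wt q a) r B - 1) * ?D B * ?D (V - B)" .
    qed simp
    also have "\<dots> = ?D V" by (rule conn_poly_rec[symmetric]) (use fin psubset.prems s E in auto)
    finally show ?thesis .
  qed
qed

lemma tree_weight_eq: "tree_weight n a q T = rooted_weight {0..n} a q 0 T"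
proof -
  have "tree_path T = root_path T 0" "tree_parent T = rooted_parent T 0"
    by (auto simp: fun_eq_iff tree_path_def root_path_def tree_parent_def rooted_parent_def)
  then show ?thesis
    by (simp add: tree_weight_def rooted_weight_def Inv_def rooted_inv_def descendant_def)
qed

subsection \<open>Threshold graphs and the Tutte polynomial\<close>

lemma threshold_graph_simple:
  assumes "threshold_graph V E"
  shows "finite V \<and> V \<noteq> {} \<and> (\<forall>e\<in>E. card e = 2) \<and> E \<subseteq> Pow V"
  using assms
proof induction
  case (dominating V E v)
  have "card {u, v} = 2" if "u \<in> V" for u
  proof -
    have "u \<noteq> v" using that dominating.hyps(2) by auto
    then show ?thesis by simp
  qed
  then show ?case using dominating by auto
qed auto

text \<open>The vicinal preorder of a threshold graph is total: a new vertex is comparable with all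
  others, and it is joined to all old vertices or to none, so old comparisons survive.\<close>

lemma threshold_graph_nested:
  assumes "threshold_graph V E" "u \<in> V" "v \<in> V"
  shows "(\<forall>w. w \<noteq> u \<longrightarrow> w \<noteq> v \<longrightarrow> {u, w} \<in> E \<longrightarrow> {v, w} \<in> E) \<or>
         (\<forall>w. w \<noteq> u \<longrightarrow> w \<noteq> v \<longrightarrow> {v, w} \<in> E \<longrightarrow> {u, w} \<in> E)"
  using assms
proof (induction arbitrary: u v)
  case (single x)
  then show ?case by auto
next
  case (isolated V E x)
  then have no: "{x, w} \<notin> E" for w using threshold_graph_simple[OF isolated(1)] by auto
  show ?case
  proof (cases "u = x \<or> v = x")
    case True
    then show ?thesis using no by auto
  next
    case False
    then show ?thesis using isolated by auto
  qed
next
  case (dominating V E x)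
  have sub: "E \<subseteq> Pow V" using threshold_graph_simple[OF dominating(1)] by auto
  have ed: "{y, w} \<in> E \<union> {{u, x} |u. u \<in> V} \<longleftrightarrow> {y, w} \<in> E \<or> (y = x \<and> w \<in> V) \<or> (w = x \<and> y \<in> V)" for y w
    by (auto simp: doubleton_eq_iff)
  consider "u = x" | "v = x" | "u \<in> V" "v \<in> V" using dominating by auto
  then show ?case
  proof cases
    case 1
    then show ?thesis using sub unfolding ed by auto
  next
    case 2
    then show ?thesis using sub unfolding ed by auto
  next
    case 3
    then have "u \<noteq> x" "v \<noteq> x" using dominating by auto
    then show ?thesis using 3 dominating.IH[OF 3] unfolding ed by auto
  qed
qed

lemma degree_of_eq:
  assumes "\<forall>e\<in>E. card e = 2"
  shows "degree_of E v = card {w. {v, w} \<in> E}"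
proof -
  have "{e \<in> E. v \<in> e} = (\<lambda>w. {v, w}) ` {w. {v, w} \<in> E}"
  proof (intro equalityI subsetI)
    fix e assume "e \<in> {e \<in> E. v \<in> e}"
    then obtain w where "e = {v, w}" "e \<in> E" using assms edge_pair by (metis (mono_tags, lifting) mem_Collect_eq)
    then show "e \<in> (\<lambda>w. {v, w}) ` {w. {v, w} \<in> E}" by auto
  qed auto
  moreover have "inj_on (\<lambda>w. {v, w}) {w. {v, w} \<in> E}" by (auto simp: inj_on_def doubleton_eq_iff)
  ultimately show ?thesis by (simp add: degree_of_def card_image)
qed

text \<open>If \<open>k\<close> is a neighbour of \<open>j\<close> but not of \<open>i\<close>,
  nestedness makes all neighbours of \<open>i\<close> other than \<open>j\<close> neighbours of
  \<open>j\<close>. Then \<open>i\<close> has smaller degree than \<open>j\<close>, against the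
  labeling.\<close>

lemma threshold_graph_shifted:
  assumes "threshold_graph {0..n} E" "reverse_degree_labeled n E"
  shows "shifted E"
  unfolding shifted_def
proof (intro allI impI, elim conjE, rule ccontr)
  fix i j k assume ij: "i < j" "k \<noteq> i" and jk: "{j, k} \<in> E" and ik: "{i, k} \<notin> E"
  have E: "\<forall>e\<in>E. card e = 2" "E \<subseteq> Pow {0..n}" using threshold_graph_simple[OF assms(1)] by auto
  then have n: "j \<le> n" "k \<le> n" using jk by auto
  have kj: "k \<noteq> j"
  proof
    assume "k = j"
    then have "card {j, k} = 1" by simp
    then show False using E jk by fastforce
  qed
  have nest: "{j, w} \<in> E" if "w \<noteq> i" "w \<noteq> j" "{i, w} \<in> E" for w
    using threshold_graph_nested[OF assms(1), of i j] ij n jk ik kj that by auto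
  \<comment> \<open>If \<open>i\<close> and \<open>j\<close> are adjacent, then \<open>j\<close> is
    in \<open>?N i\<close> but not in \<open>?N j\<close>; sending it to \<open>i\<close> repairs
    this. The image misses \<open>k\<close>.\<close>
  let ?N = "\<lambda>v. {w. {v, w} \<in> E}" and ?f = "\<lambda>w. if w = j then i else w"
  have nii: "{v, v} \<notin> E" for v using E(1) by force
  have "inj_on ?f (?N i)" using nii[of i] by (auto simp: inj_on_def)
  moreover have "?f ` ?N i \<subset> ?N j"
  proof
    show "?f ` ?N i \<subseteq> ?N j"
    proof (rule image_subsetI)
      fix w assume "w \<in> ?N i"
      then show "?f w \<in> ?N j" using nest[of w] nii[of i] by (cases "w = i") (auto simp: insert_commute)
    qed
    have "k \<in> ?N j" "k \<notin> ?f ` ?N i" using jk ik ij by auto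
    then show "?f ` ?N i \<noteq> ?N j" by blast
  qed
  moreover have "finite (?N j)" by (rule finite_subset[of _ "{0..n}"]) (use E in auto)
  ultimately have "card (?N i) < card (?N j)" by (metis (no_types, lifting) card_image psubset_card_mono)
  then show False
    using assms(2) ij n by (auto simp: reverse_degree_labeled_def degree_of_eq[OF E(1)] not_le[symmetric])
qed

text \<open>Group the subsets by their image under \<open>fst\<close>: an element \<open>e\<close>
  of the image contributes the sum of \<open>y ^ card S\<close> over nonempty
  \<open>S \<subseteq> N e\<close>. The function \<open>f\<close> is general because the induction
  step also uses \<open>f\<close> composed with \<open>insert e\<close>.\<close>

lemma sum_Pow_Sigma:
  fixes y :: "'a::comm_ring_1"
  assumes "finite F" "\<And>e. finite (N e)"
  shows "(\<Sum>A\<in>Pow (Sigma F N). f (fst ` A) * y ^ card A)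
       = (\<Sum>A\<in>Pow F. f A * (\<Prod>e\<in>A. (1 + y) ^ card (N e) - 1))"
  using assms(1)
proof (induction F arbitrary: f)
  case (insert e F)
  have finS: "finite (Sigma F N)" using insert assms(2) by auto
  have pw: "(\<Sum>S\<in>Pow (N e). y ^ card S) = (1 + y) ^ card (N e)"
    using prod_eq_sum_Pow[OF assms(2)[of e], of "\<lambda>_. 1 + y"] by simp
  have pw': "(\<Sum>S\<in>Pow (N e) - {{}}. y ^ card S) = (1 + y) ^ card (N e) - 1"
    using sum.remove[of "Pow (N e)" "{}" "\<lambda>S. y ^ card S"] assms(2)[of e] pw by (simp add: algebra_simps)
  have "(\<Sum>A\<in>Pow (Sigma (insert e F) N). f (fst ` A) * y ^ card A)
      = (\<Sum>(A, S)\<in>Pow (Sigma F N) \<times> Pow (N e). f (fst ` (A \<union> Pair e ` S)) * y ^ card (A \<union> Pair e ` S))"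
    by (rule sum.reindex_bij_witness[where i = "\<lambda>(A, S). A \<union> Pair e ` S" and
          j = "\<lambda>A. (A \<inter> Sigma F N, {m. (e, m) \<in> A})"])
       (use insert(2) in \<open>auto intro!: arg_cong2[of _ _ _ _ "\<lambda>A B. f (fst ` A) * y ^ card B"]\<close>)
  also have "\<dots> = (\<Sum>A\<in>Pow (Sigma F N). \<Sum>S\<in>Pow (N e). f (fst ` (A \<union> Pair e ` S)) * y ^ card (A \<union> Pair e ` S))"
    by (simp add: sum.cartesian_product)
  also have "\<dots> = (\<Sum>A\<in>Pow (Sigma F N). f (fst ` A) * y ^ card A +
      ((1 + y) ^ card (N e) - 1) * (f (insert e (fst ` A)) * y ^ card A))"
  proof (rule sum.cong)
    fix A assume A: "A \<in> Pow (Sigma F N)"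
    have finA: "finite A" using A finS finite_subset by auto
    have c: "card (A \<union> Pair e ` S) = card A + card S" if "S \<in> Pow (N e)" for S
    proof -
      have "finite S" using that assms(2) finite_subset by auto
      moreover have "A \<inter> Pair e ` S = {}" using A insert(2) by auto
      ultimately show ?thesis using finA by (simp add: card_Un_disjoint card_image inj_on_def)
    qed
    have "(\<Sum>S\<in>Pow (N e). f (fst ` (A \<union> Pair e ` S)) * y ^ card (A \<union> Pair e ` S))
      = f (fst ` A) * y ^ card A + (\<Sum>S\<in>Pow (N e) - {{}}. f (fst ` (A \<union> Pair e ` S)) * y ^ card (A \<union> Pair e ` S))"
      by (subst sum.remove[of _ "{}"]) (use assms(2) in auto)
    also have "(\<Sum>S\<in>Pow (N e) - {{}}. f (fst ` (A \<union> Pair e ` S)) * y ^ card (A \<union> Pair e ` S))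
      = (\<Sum>S\<in>Pow (N e) - {{}}. f (insert e (fst ` A)) * y ^ card A * y ^ card S)"
    proof (rule sum.cong)
      fix S assume S: "S \<in> Pow (N e) - {{}}"
      then have "fst ` (A \<union> Pair e ` S) = insert e (fst ` A)" by (auto simp: image_Un image_image)
      then show "f (fst ` (A \<union> Pair e ` S)) * y ^ card (A \<union> Pair e ` S)
        = f (insert e (fst ` A)) * y ^ card A * y ^ card S"
        using c[of S] S by (simp add: power_add mult.assoc)
    qed simp
    also have "\<dots> = ((1 + y) ^ card (N e) - 1) * (f (insert e (fst ` A)) * y ^ card A)"
      unfolding sum_distrib_left[symmetric] pw' by (rule mult.commute)
    finally show "(\<Sum>S\<in>Pow (N e). f (fst ` (A \<union> Pair e ` S)) * y ^ card (A \<union> Pair e ` S))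
      = f (fst ` A) * y ^ card A + ((1 + y) ^ card (N e) - 1) * (f (insert e (fst ` A)) * y ^ card A)" .
  qed simp
  also have "\<dots> = (\<Sum>A\<in>Pow F. f A * (\<Prod>e\<in>A. (1 + y) ^ card (N e) - 1)) +
      ((1 + y) ^ card (N e) - 1) * (\<Sum>A\<in>Pow F. f (insert e A) * (\<Prod>e\<in>A. (1 + y) ^ card (N e) - 1))"
    unfolding sum.distrib sum_distrib_left[symmetric] insert.IH[of f] insert.IH[of "\<lambda>A. f (insert e A)"] ..
  also have "\<dots> = (\<Sum>A\<in>Pow (insert e F). f A * (\<Prod>e\<in>A. (1 + y) ^ card (N e) - 1))"
    unfolding sum_Pow_insert[OF insert(1,2)] sum_distrib_left
  proof (intro arg_cong2[of _ _ _ _ "(+)"] refl sum.cong)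
    fix A assume "A \<in> Pow F"
    then have "finite A" "e \<notin> A" using insert finite_subset by auto
    then show "((1 + y) ^ card (N e) - 1) * (f (insert e A) * (\<Prod>e\<in>A. (1 + y) ^ card (N e) - 1))
      = f (insert e A) * (\<Prod>e\<in>insert e A. (1 + y) ^ card (N e) - 1)"
      by (simp add: mult_ac)
  qed
  finally show ?case .
qed simp

lemma num_components:
  assumes "finite V" "V \<noteq> {}"
  shows "num_components V A \<ge> 1" and "num_components V A = 1 \<longleftrightarrow> conn V A"
proof -
  let ?R = "{(u, v). u \<in> V \<and> v \<in> V \<and> (\<exists>p. is_path A u p v)}"
  have R: "?R = {(u, v). u \<in> V \<and> v \<in> V \<and> (u, v) \<in> (adj A)\<^sup>*}" by (simp add: ex_path_iff)
  have fin: "finite (V // ?R)"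
    by (rule finite_subset[of _ "Pow V"]) (use assms in \<open>auto simp: quotient_def\<close>)
  have "V // ?R \<noteq> {}" using assms by (simp add: quotient_is_empty)
  then show "num_components V A \<ge> 1"
    using fin by (simp add: num_components_def Suc_le_eq card_gt_0_iff)
  show "num_components V A = 1 \<longleftrightarrow> conn V A"
  proof
    assume "num_components V A = 1"
    then obtain X where X: "V // ?R = {X}" by (auto simp: num_components_def card_1_singleton_iff)
    have cl: "?R `` {u} = X" if "u \<in> V" for u using X that quotientI[of u V ?R] by auto
    show "conn V A"
      unfolding conn_def
    proof (intro ballI)
      fix u v assume uv: "u \<in> V" "v \<in> V"
      then have "v \<in> ?R `` {v}" unfolding R by auto
      then have "v \<in> ?R `` {u}" unfolding cl[OF uv(1)] cl[OF uv(2)] .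
      then show "(u, v) \<in> (adj A)\<^sup>*" unfolding R by auto
    qed
  next
    assume "conn V A"
    then have "?R `` {u} = V" if "u \<in> V" for u using that unfolding R conn_def by auto
    then have "V // ?R = {V}" using assms unfolding quotient_def by auto
    then show "num_components V A = 1" by (simp add: num_components_def)
  qed
qed

text \<open>At \<open>x = 1\<close> the first factor is a power of 0 and selects the connected
  \<open>A\<close>. The second exponent is then \<open>card A + 1 - card V\<close>, and
  \<open>(q - 1) ^ (card V - 1)\<close> completes it to \<open>card A\<close>.\<close>

lemma tutte_conn_poly:
  fixes q :: "'a::comm_ring_1"
  assumes fin: "finite V" "V \<noteq> {}" and E: "\<forall>e\<in>E. card e = 2" "E \<subseteq> Pow V"
    and pos: "\<forall>e\<in>E. a (Max e) > 0" and c: "connected_graph V E"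
  shows "(q - 1) ^ (card V - 1) * tutte V (parallel_edges E a) fst 1 q = conn_poly E (max_wt q a) V"
proof -
  have finE: "finite E" using fin E finite_edges by blast
  let ?P = "parallel_edges E a"
  have finP: "finite ?P" using finE by (simp add: parallel_edges_def)
  \<comment> \<open>Every edge keeps at least one copy, so the multigraph is connected like
    \<open>E\<close>.\<close>
  have "fst ` ?P = E" using pos by (force simp: parallel_edges_def image_iff)
  then have k1: "num_components V (fst ` ?P) = 1" using num_components(2)[OF fin] c connected_graph_iff by metis
  have "(q - 1) ^ (card V - 1) * tutte V ?P fst 1 q
     = (\<Sum>A\<in>Pow ?P. of_bool (conn V (fst ` A)) * (q - 1) ^ card A)"
    unfolding tutte_def sum_distrib_left
  proof (rule sum.cong)
    fix A assume A: "A \<in> Pow ?P"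
    show "(q - 1) ^ (card V - 1) * ((1 - 1) ^ (num_components V (fst ` A) - num_components V (fst ` ?P))
        * (q - 1) ^ (num_components V (fst ` A) + card A - card V))
      = of_bool (conn V (fst ` A)) * (q - 1) ^ card A"
    proof (cases "conn V (fst ` A)")
      case True
      have "fst ` A \<subseteq> E" using A by (auto simp: parallel_edges_def)
      \<comment> \<open>This bound keeps the natural number exponent from truncating.\<close>
      then have "card V \<le> card (fst ` A) + 1" using fin E True by (intro card_conn) auto
      moreover have "card (fst ` A) \<le> card A" using A finP finite_subset by (intro card_image_le) auto
      moreover have "card V > 0" using fin by (simp add: card_gt_0_iff)
      ultimately have "card V - 1 + (1 + card A - card V) = card A" by simp
      moreover have "num_components V (fst ` A) = 1" using True num_components(2)[OF fin] by auto
      ultimately show ?thesis using True k1 by (simp flip: power_add)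
    next
      case False
      then have "num_components V (fst ` A) > 1" using num_components[OF fin, of "fst ` A"] by auto
      then show ?thesis using False k1 by (simp add: zero_power)
    qed
  qed simp
  also have "\<dots> = (\<Sum>A\<in>Pow E. of_bool (conn V A) * (\<Prod>e\<in>A. max_wt q a e - 1))"
    unfolding parallel_edges_def by (subst sum_Pow_Sigma[OF finE]) simp_all
  also have "\<dots> = (\<Sum>A\<in>{A \<in> Pow E. conn V A}. \<Prod>e\<in>A. max_wt q a e - 1)"
    by (rule sum.mono_neutral_cong_right) (use finE in auto)
  also have "{A \<in> Pow E. conn V A} = {A. A \<subseteq> E \<inter> Pow V \<and> conn V A}" using E by auto
  finally show ?thesis by (simp add: conn_poly_def)
qed

subsection \<open>Flows at t = 1\<close>

lemma finite_directed_edges: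
  assumes "E \<subseteq> Pow {0..n}"
  shows "finite (directed_edges E)"
  by (rule finite_subset[of _ "{0..n} \<times> {0..n}"]) (use assms in \<open>auto simp: directed_edges_def\<close>)

text \<open>The labels act as a potential: an edge drops by its length \<open>fst e - snd e\<close>,
  which is at least 1. This bounds every flow value by the supplies.\<close>

lemma sum_net_flow:
  assumes "E \<subseteq> Pow {0..n}"
  shows "(\<Sum>k=0..n. real k * net_flow E x k) = (\<Sum>e\<in>directed_edges E. (real (fst e) - real (snd e)) * x e)"
proof -
  let ?d = "directed_edges E"
  have fin: "finite ?d" using assms by (rule finite_directed_edges)
  have im: "fst ` ?d \<subseteq> {0..n}" "snd ` ?d \<subseteq> {0..n}" using assms by (auto simp: directed_edges_def)
  have "(\<Sum>k=0..n. real k * net_flow E x k) =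
    (\<Sum>k=0..n. \<Sum>e\<in>{e \<in> ?d. fst e = k}. real (fst e) * x e)
    - (\<Sum>k=0..n. \<Sum>e\<in>{e \<in> ?d. snd e = k}. real (snd e) * x e)"
    by (simp add: net_flow_def sum_subtractf right_diff_distrib sum_distrib_left)
  also have "\<dots> = (\<Sum>e\<in>?d. real (fst e) * x e) - (\<Sum>e\<in>?d. real (snd e) * x e)"
    using sum.group[OF fin _ im(1), of "\<lambda>e. real (fst e) * x e"]
      sum.group[OF fin _ im(2), of "\<lambda>e. real (snd e) * x e"] by simp
  finally show ?thesis by (simp add: sum_subtractf left_diff_distrib)
qed

text \<open>An infinite set of flows would make \<open>Ehr\<close> the junk value \<open>0\<close>.\<close>

lemma finite_integer_flows:
  assumes E: "E \<subseteq> Pow {0..n}"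
  shows "finite (integer_flows n E a)"
proof -
  let ?d = "directed_edges E"
  have fin: "finite ?d" using assms by (rule finite_directed_edges)
  \<comment> \<open>By \<open>sum_net_flow\<close> this is the total of edge length times flow,
    hence at least each single \<open>A e\<close>.\<close>
  define M where "M = nat \<lceil>\<Sum>k=0..n. real k * a k\<rceil>"
  have "integer_flows n E a \<subseteq> ?d \<rightarrow>\<^sub>E real ` {0..M}"
  proof
    fix A assume A: "A \<in> integer_flows n E a"
    then have f: "A \<in> ?d \<rightarrow>\<^sub>E {0..}" "A \<in> ?d \<rightarrow>\<^sub>E \<int>" "\<And>k. k \<in> {1..n} \<Longrightarrow> net_flow E A k = a k"
      by (auto simp: integer_flows_def flow_polytope_def)
    have nn: "A e \<ge> 0" if "e \<in> ?d" for e using PiE_mem[OF f(1) that] by simp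
    have "A e \<in> real ` {0..M}" if e: "e \<in> ?d" for e
    proof -
      have "A e \<in> \<int>" using PiE_mem[OF f(2) e] .
      then obtain m where m: "A e = real m" using nn[OF e] by (metis Ints_cases of_int_0_le_iff of_nat_nat)
      have d: "real (fst e') - real (snd e') \<ge> 1" if "e' \<in> ?d" for e'
        using that by (auto simp: directed_edges_def)
      have "A e \<le> (real (fst e) - real (snd e)) * A e"
        using mult_right_mono[OF d[OF e] nn[OF e]] by simp
      also have "\<dots> \<le> (\<Sum>e\<in>?d. (real (fst e) - real (snd e)) * A e)"
      proof (rule member_le_sum[OF e _ fin])
        fix x assume "x \<in> ?d - {e}"
        then show "0 \<le> (real (fst x) - real (snd x)) * A x" using d[of x] nn[of x] by simp
      qed
      also have "\<dots> = (\<Sum>k=0..n. real k * net_flow E A k)" using sum_net_flow[OF E] by simp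
      also have "\<dots> = (\<Sum>k=0..n. real k * a k)"
      proof (rule sum.cong)
        fix k assume "k \<in> {0..n}"
        then show "real k * net_flow E A k = real k * a k" using f(3)[of k] by (cases "k = 0") auto
      qed simp
      finally have "m \<le> M" using m unfolding M_def by linarith
      then show ?thesis using m by auto
    qed
    then show "A \<in> ?d \<rightarrow>\<^sub>E real ` {0..M}" using PiE_arb[OF f(1)] by (intro PiE_I) auto
  qed
  moreover have "finite (?d \<rightarrow>\<^sub>E real ` {0..M})" using fin by (intro finite_PiE) auto
  ultimately show ?thesis by (rule finite_subset)
qed

text \<open>
  At \<open>t = 1\<close> the factor \<open>(1 - t)\<close> kills every flow with more than \<open>n\<close> positive edges; in the surviving
  ones each vertex other than \<open>0\<close> sends its whole flow along a single edge.
\<close>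

definition unit_flows :: "nat \<Rightarrow> nat set set \<Rightarrow> (nat \<Rightarrow> nat) \<Rightarrow> (nat \<times> nat \<Rightarrow> real) set" where
  "unit_flows n E a = {A \<in> integer_flows n E (\<lambda>k. real (a k)). card {e \<in> directed_edges E. A e > 0} = n}"

definition flow_prod :: "nat set set \<Rightarrow> 'a::idom_divide \<Rightarrow> (nat \<times> nat \<Rightarrow> real) \<Rightarrow> 'a" where
  "flow_prod E q A = (\<Prod>e\<in>directed_edges E. weight q 1 (nat \<lfloor>A e\<rfloor>))"

lemma Ehr_unit_flows:
  assumes E: "E \<subseteq> Pow {0..n}" and pos: "\<forall>k\<in>{1..n}. a k > 0"
  shows "Ehr n E (\<lambda>k. real (a k)) q 1 = (\<Sum>A\<in>unit_flows n E a. flow_prod E q A)"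
  unfolding Ehr_def
proof (rule sum.mono_neutral_cong_right)
  show "finite (integer_flows n E (\<lambda>k. real (a k)))" using E by (rule finite_integer_flows)
  show "unit_flows n E a \<subseteq> integer_flows n E (\<lambda>k. real (a k))" by (auto simp: unit_flows_def)
  show "flow_weight n E q 1 A = flow_prod E q A" if "A \<in> unit_flows n E a" for A
    using that by (simp add: unit_flows_def flow_weight_def flow_prod_def)
  show "\<forall>A\<in>integer_flows n E (\<lambda>k. real (a k)) - unit_flows n E a. flow_weight n E q 1 A = 0"
  proof
    fix A assume A: "A \<in> integer_flows n E (\<lambda>k. real (a k)) - unit_flows n E a"
    let ?c = "card {e \<in> directed_edges E. A e > 0}"
    have "finite E" by (rule finite_edges[OF _ E]) simp
    \<comment> \<open>With this bound \<open>?c \<noteq> n\<close> gives a positive exponent, hence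
      a power of 0 that vanishes; below \<open>n\<close> the subtraction would truncate to
      0.\<close>
    then have "n \<le> ?c"
      by (rule card_positive_edges[where a = "\<lambda>k. real (a k)"]) (use A pos in \<open>auto simp: integer_flows_def\<close>)
    moreover have "?c \<noteq> n" using A by (auto simp: unit_flows_def)
    ultimately show "flow_weight n E q 1 A = 0" by (simp add: flow_weight_def zero_power)
  qed
qed

section \<open>Deleting the largest vertex from a flow\<close>

abbreviation upto_edges :: "nat set set \<Rightarrow> nat \<Rightarrow> nat set set" where
  "upto_edges E n \<equiv> E \<inter> Pow {0..n}"

abbreviation top_nbrs :: "nat set set \<Rightarrow> nat \<Rightarrow> nat set" where
  "top_nbrs E n \<equiv> {j \<in> {0..n}. {Suc n, j} \<in> E}"

lemma directed_edges_Suc: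
  "directed_edges (upto_edges E (Suc n)) =
     directed_edges (upto_edges E n) \<union> Pair (Suc n) ` top_nbrs E n"
  by (auto simp: directed_edges_def le_Suc_eq image_iff)

lemma directed_edges_Suc_disj:
  "directed_edges (upto_edges E n) \<inter> Pair (Suc n) ` top_nbrs E n = {}"
  by (auto simp: directed_edges_def)

lemma net_flow_Suc:
  assumes "k \<le> n"
  shows "net_flow (upto_edges E (Suc n)) x k =
    net_flow (upto_edges E n) x k - (if k \<in> top_nbrs E n then x (Suc n, k) else 0)"
proof -
  let ?d = "directed_edges (upto_edges E n)" and ?d' = "directed_edges (upto_edges E (Suc n))"
  have fin: "finite {e \<in> ?d. snd e = k}" using finite_directed_edges[of "upto_edges E n" n] by simp
  have "{e \<in> ?d'. fst e = k} = {e \<in> ?d. fst e = k}"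
    unfolding directed_edges_Suc using assms by auto
  moreover have "(\<Sum>e\<in>{e \<in> ?d'. snd e = k}. x e) = (\<Sum>e\<in>{e \<in> ?d. snd e = k}. x e)
     + (if k \<in> top_nbrs E n then x (Suc n, k) else 0)"
  proof (cases "k \<in> top_nbrs E n")
    case True
    then have "{e \<in> ?d'. snd e = k} = insert (Suc n, k) {e \<in> ?d. snd e = k}"
      unfolding directed_edges_Suc by auto
    moreover have "(Suc n, k) \<notin> ?d" by (auto simp: directed_edges_def)
    ultimately show ?thesis using True fin by simp
  next
    case False
    then have "{e \<in> ?d'. snd e = k} = {e \<in> ?d. snd e = k}"
      unfolding directed_edges_Suc by auto
    then show ?thesis unfolding if_not_P[OF False] by simp
  qed
  ultimately show ?thesis by (simp add: net_flow_def)
qed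

lemma net_flow_top:
  "net_flow (upto_edges E (Suc n)) x (Suc n) = (\<Sum>j\<in>top_nbrs E n. x (Suc n, j))"
proof -
  let ?d' = "directed_edges (upto_edges E (Suc n))"
  have d: "{e \<in> ?d'. fst e = Suc n} = Pair (Suc n) ` top_nbrs E n" "{e \<in> ?d'. snd e = Suc n} = {}"
    by (auto simp: directed_edges_def)
  show ?thesis unfolding net_flow_def d by (simp add: sum.reindex inj_on_def)
qed

lemma net_flow_cong:
  assumes "\<And>e. e \<in> directed_edges E \<Longrightarrow> x e = y e"
  shows "net_flow E x k = net_flow E y k"
  unfolding net_flow_def using assms by (intro arg_cong2[of _ _ _ _ "(-)"] sum.cong) auto

text \<open>What \<open>k\<close> received from the deleted vertex becomes extra supply at
  \<open>k\<close>.\<close>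

lemma flow_polytope_Suc:
  fixes a :: "nat \<Rightarrow> real"
  assumes A: "A \<in> directed_edges (upto_edges E (Suc n)) \<rightarrow>\<^sub>E {0..}"
  defines "b \<equiv> \<lambda>k. a k + (if k \<in> top_nbrs E n then A (Suc n, k) else 0)"
  shows "A \<in> flow_polytope (Suc n) (upto_edges E (Suc n)) a \<longleftrightarrow>
    (\<Sum>j\<in>top_nbrs E n. A (Suc n, j)) = a (Suc n) \<and>
    restrict A (directed_edges (upto_edges E n)) \<in> flow_polytope n (upto_edges E n) b"
proof -
  let ?d = "directed_edges (upto_edges E n)" and ?N = "top_nbrs E n"
  let ?nf = "net_flow (upto_edges E n) (restrict A ?d)"
  have nf: "net_flow (upto_edges E n) A k = ?nf k" for k by (rule net_flow_cong) simp
  have R: "restrict A ?d \<in> ?d \<rightarrow>\<^sub>E {0..}" using A unfolding directed_edges_Suc by (auto simp: PiE_def Pi_def)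
  have eq: "net_flow (upto_edges E (Suc n)) A k = a k \<longleftrightarrow> ?nf k = b k" if "k \<in> {1..n}" for k
    using that net_flow_Suc[of k n E A] nf[of k] by (auto simp: b_def)
  have sumN: "(\<Sum>j\<in>?N. A (Suc n, j)) = (if 0 \<in> ?N then A (Suc n, 0) else 0)
      + (\<Sum>k=1..n. if k \<in> ?N then A (Suc n, k) else 0)"
  proof -
    have "(\<Sum>j\<in>?N. A (Suc n, j)) = (\<Sum>k=0..n. if {Suc n, k} \<in> E then A (Suc n, k) else 0)"
      by (subst sum.inter_filter[symmetric]) auto
    also have "\<dots> = (if {Suc n, 0} \<in> E then A (Suc n, 0) else 0) + (\<Sum>k=1..n. if {Suc n, k} \<in> E then A (Suc n, k) else 0)"
      by (subst sum.atLeast_Suc_atMost) auto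
    finally show ?thesis by simp
  qed
  have "(\<forall>k\<in>{1..Suc n}. net_flow (upto_edges E (Suc n)) A k = a k) \<longleftrightarrow>
     (\<forall>k\<in>{1..n}. ?nf k = b k) \<and> (\<Sum>j\<in>?N. A (Suc n, j)) = a (Suc n)"
  proof -
    have "{1..Suc n} = insert (Suc n) {1..n}" by auto
    then show ?thesis using eq net_flow_top[of E n A] by auto
  qed
  \<comment> \<open>The supplies \<open>b\<close> on \<open>{1..n}\<close> total those of
    \<open>a\<close> on \<open>{1..Suc n}\<close> minus the flow sent directly to 0, which is also
    what the inflow of 0 loses.\<close>
  moreover have "net_flow (upto_edges E (Suc n)) A 0 = - (\<Sum>i=1..Suc n. a i) \<longleftrightarrow> ?nf 0 = - (\<Sum>i=1..n. b i)"
    if "(\<Sum>j\<in>?N. A (Suc n, j)) = a (Suc n)"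
    using net_flow_Suc[of 0 n E A] nf[of 0] sumN that by (simp add: b_def sum.distrib) argo
  ultimately show ?thesis using A R by (auto simp: flow_polytope_def)
qed

definition extend_flow :: "nat set set \<Rightarrow> nat \<Rightarrow> real \<Rightarrow> nat \<Rightarrow> (nat \<times> nat \<Rightarrow> real) \<Rightarrow> nat \<times> nat \<Rightarrow> real" where
  "extend_flow E n c j A = restrict
     (\<lambda>e. if e \<in> directed_edges (upto_edges E n) then A e else if e = (Suc n, j) then c else 0)
     (directed_edges (upto_edges E (Suc n)))"

lemma extend_flow_simps:
  shows "e \<in> directed_edges (upto_edges E n) \<Longrightarrow> extend_flow E n c j A e = A e"
    and "i \<in> top_nbrs E n \<Longrightarrow> extend_flow E n c j A (Suc n, i) = (if i = j then c else 0)"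
  by (auto simp: extend_flow_def directed_edges_Suc) (auto simp: directed_edges_def)

lemma card_pos_Suc:
  "card {e \<in> directed_edges (upto_edges E (Suc n)). A e > (0::real)} =
   card {e \<in> directed_edges (upto_edges E n). A e > 0} + card {j \<in> top_nbrs E n. A (Suc n, j) > 0}"
proof -
  let ?S = "{j \<in> top_nbrs E n. A (Suc n, j) > 0}"
  have "{e \<in> directed_edges (upto_edges E (Suc n)). A e > 0} =
    {e \<in> directed_edges (upto_edges E n). A e > 0} \<union> Pair (Suc n) ` ?S"
    unfolding directed_edges_Suc by auto
  moreover have "card (Pair (Suc n) ` ?S) = card ?S" by (rule card_image) (simp add: inj_on_def)
  moreover have "{e \<in> directed_edges (upto_edges E n). A e > 0} \<inter> Pair (Suc n) ` ?S = {}"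
    using directed_edges_Suc_disj[of E n] by auto
  ultimately show ?thesis
    using finite_directed_edges[of "upto_edges E n" n] by (simp add: card_Un_disjoint)
qed

lemma extend_flow_unit:
  assumes pos: "a (Suc n) > 0" and j: "j \<in> top_nbrs E n"
    and A: "A \<in> unit_flows n (upto_edges E n) (a(j := a j + a (Suc n)))"
  shows "extend_flow E n (real (a (Suc n))) j A \<in> unit_flows (Suc n) (upto_edges E (Suc n)) a"
    and "restrict (extend_flow E n (real (a (Suc n))) j A) (directed_edges (upto_edges E n)) = A"
proof -
  let ?d = "directed_edges (upto_edges E n)" and ?d' = "directed_edges (upto_edges E (Suc n))"
  let ?X = "extend_flow E n (real (a (Suc n))) j A" and ?b = "a(j := a j + a (Suc n))"
  have A': "A \<in> ?d \<rightarrow>\<^sub>E {0..}" "A \<in> ?d \<rightarrow>\<^sub>E \<int>" "A \<in> flow_polytope n (upto_edges E n) (\<lambda>k. real (?b k))"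
    "card {e \<in> ?d. A e > 0} = n"
    using A by (auto simp: unit_flows_def integer_flows_def flow_polytope_def)
  show r: "restrict ?X ?d = A"
    using A'(1) by (auto simp: fun_eq_iff restrict_def PiE_def extensional_def extend_flow_simps)
  have X: "?X \<in> ?d' \<rightarrow>\<^sub>E {0..}" "?X \<in> ?d' \<rightarrow>\<^sub>E \<int>"
    using A'(1,2) unfolding extend_flow_def by (auto simp: PiE_def Pi_def)
  have "(\<lambda>k. real (a k) + (if k \<in> top_nbrs E n then ?X (Suc n, k) else 0)) = (\<lambda>k. real (?b k))"
    using j by (auto simp: fun_eq_iff extend_flow_simps)
  moreover have "(\<Sum>i\<in>top_nbrs E n. ?X (Suc n, i)) = (\<Sum>i\<in>top_nbrs E n. if i = j then real (a (Suc n)) else 0)"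
    by (rule sum.cong) (auto simp: extend_flow_simps)
  then have "(\<Sum>i\<in>top_nbrs E n. ?X (Suc n, i)) = real (a (Suc n))" using j by simp
  ultimately have "?X \<in> flow_polytope (Suc n) (upto_edges E (Suc n)) (\<lambda>k. real (a k))"
    using flow_polytope_Suc[OF X(1), of "\<lambda>k. real (a k)"] r A'(3) by simp
  moreover have "{i \<in> top_nbrs E n. ?X (Suc n, i) > 0} = {j}"
    using j pos by (auto simp: extend_flow_simps split: if_splits)
  moreover have "{e \<in> ?d. ?X e > 0} = {e \<in> ?d. A e > 0}" by (auto simp: extend_flow_simps)
  ultimately show "?X \<in> unit_flows (Suc n) (upto_edges E (Suc n)) a"
    using X(2) A'(4) card_pos_Suc[of E n ?X] by (simp add: unit_flows_def integer_flows_def)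
qed

text \<open>The restricted flow has positive supplies, so \<open>card_positive_edges\<close> gives
  it at least \<open>n\<close> positive edges. The deleted vertex uses at least one more, and since
  the total is \<open>Suc n\<close>, exactly one.\<close>

lemma unit_flow_top:
  assumes pos: "\<forall>k\<in>{1..Suc n}. a k > 0"
    and X: "X \<in> unit_flows (Suc n) (upto_edges E (Suc n)) a"
  shows "\<exists>j\<in>top_nbrs E n. {j \<in> top_nbrs E n. X (Suc n, j) > 0} = {j} \<and>
    restrict X (directed_edges (upto_edges E n)) \<in> unit_flows n (upto_edges E n) (a(j := a j + a (Suc n))) \<and>
    X = extend_flow E n (real (a (Suc n))) j (restrict X (directed_edges (upto_edges E n)))"
proof -
  let ?d = "directed_edges (upto_edges E n)" and ?d' = "directed_edges (upto_edges E (Suc n))"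
  let ?N = "top_nbrs E n" and ?R = "restrict X (directed_edges (upto_edges E n))"
  let ?b = "\<lambda>k. real (a k) + (if k \<in> ?N then X (Suc n, k) else 0)"
  have X': "X \<in> ?d' \<rightarrow>\<^sub>E {0..}" "X \<in> ?d' \<rightarrow>\<^sub>E \<int>" "X \<in> flow_polytope (Suc n) (upto_edges E (Suc n)) (\<lambda>k. real (a k))"
    "card {e \<in> ?d'. X e > 0} = Suc n"
    using X by (auto simp: unit_flows_def integer_flows_def flow_polytope_def)
  have top: "(\<Sum>j\<in>?N. X (Suc n, j)) = real (a (Suc n))" and R: "?R \<in> flow_polytope n (upto_edges E n) ?b"
    using flow_polytope_Suc[OF X'(1), of "\<lambda>k. real (a k)"] X'(3) by auto
  have nn: "X (Suc n, j) \<ge> 0" if "j \<in> ?N" for j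
    using X'(1) that unfolding directed_edges_Suc by (auto simp: PiE_def Pi_def)
  have Rpos: "{e \<in> ?d. ?R e > 0} = {e \<in> ?d. X e > 0}" by auto
  have "finite (upto_edges E n)" by simp
  then have "n \<le> card {e \<in> ?d. ?R e > 0}"
  proof (rule card_positive_edges[OF _ _ R])
    show "\<forall>k\<in>{1..n}. ?b k > 0"
    proof
      fix k assume k: "k \<in> {1..n}"
      then have "a k > 0" using pos by auto
      then show "?b k > 0" using nn[of k] by (auto intro: add_pos_nonneg)
    qed
  qed
  then have c1: "n \<le> card {e \<in> ?d. X e > 0}" unfolding Rpos .
  have "\<exists>j\<in>?N. X (Suc n, j) > 0"
  proof (rule ccontr)
    assume "\<not> ?thesis"
    then have "(\<Sum>j\<in>?N. X (Suc n, j)) \<le> 0" by (intro sum_nonpos) (auto simp: not_less)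
    then show False using top pos by force
  qed
  then have "card {j \<in> ?N. X (Suc n, j) > 0} \<noteq> 0" by auto
  then have c: "card {j \<in> ?N. X (Suc n, j) > 0} = 1" "card {e \<in> ?d. X e > 0} = n"
    using c1 card_pos_Suc[of E n X] X'(4) by linarith+
  then obtain j where j: "{j \<in> ?N. X (Suc n, j) > 0} = {j}" using card_1_singletonE by blast
  then have jN: "j \<in> ?N" by auto
  have zero: "X (Suc n, i) = 0" if "i \<in> ?N" "i \<noteq> j" for i
    using nn[OF that(1)] that j by (metis (mono_tags, lifting) antisym_conv2 mem_Collect_eq singletonD)
  have "(\<Sum>i\<in>?N. X (Suc n, i)) = X (Suc n, j)"
    using jN zero by (subst sum.remove[of _ j]) auto
  then have val: "X (Suc n, i) = (if i = j then real (a (Suc n)) else 0)" if "i \<in> ?N" for i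
    using zero that top by auto
  have b: "?b = (\<lambda>k. real ((a(j := a j + a (Suc n))) k))"
    using jN by (auto simp: fun_eq_iff val)
  have "?R \<in> ?d \<rightarrow>\<^sub>E \<int>" using X'(2) unfolding directed_edges_Suc by (auto simp: PiE_def Pi_def)
  then have "?R \<in> unit_flows n (upto_edges E n) (a(j := a j + a (Suc n)))"
    using R c Rpos unfolding b by (simp add: unit_flows_def integer_flows_def)
  moreover have "X = extend_flow E n (real (a (Suc n))) j ?R"
  proof
    fix e
    consider "e \<in> ?d" | i where "e = (Suc n, i)" "i \<in> ?N" | "e \<notin> ?d'"
      unfolding directed_edges_Suc by blast
    then show "X e = extend_flow E n (real (a (Suc n))) j ?R e"
    proof cases
      case 3
      then show ?thesis using PiE_arb[OF X'(1)] by (simp add: extend_flow_def)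
    qed (use val in \<open>auto simp: extend_flow_simps\<close>)
  qed
  ultimately show ?thesis using j jN by blast
qed

lemma flow_prod_extend:
  assumes j: "j \<in> top_nbrs E n"
  shows "flow_prod (upto_edges E (Suc n)) q (extend_flow E n (real c) j A) = weight q 1 c * flow_prod (upto_edges E n) q A"
proof -
  let ?d = "directed_edges (upto_edges E n)" and ?X = "extend_flow E n (real c) j A"
  let ?w = "\<lambda>e. weight q 1 (nat \<lfloor>?X e\<rfloor>)"
  have "flow_prod (upto_edges E (Suc n)) q ?X = (\<Prod>e\<in>?d. ?w e) * (\<Prod>e\<in>Pair (Suc n) ` top_nbrs E n. ?w e)"
    unfolding flow_prod_def directed_edges_Suc
    by (rule prod.union_disjoint) (use finite_directed_edges[of "upto_edges E n" n] directed_edges_Suc_disj in auto)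
  also have "(\<Prod>e\<in>?d. ?w e) = flow_prod (upto_edges E n) q A"
    unfolding flow_prod_def by (rule prod.cong) (auto simp: extend_flow_simps)
  also have "(\<Prod>e\<in>Pair (Suc n) ` top_nbrs E n. ?w e) = (\<Prod>i\<in>top_nbrs E n. ?w (Suc n, i))"
    by (simp add: prod.reindex inj_on_def)
  \<comment> \<open>Edges without flow contribute 1, the value of \<open>weight\<close> at
    0.\<close>
  also have "\<dots> = (\<Prod>i\<in>top_nbrs E n. if i = j then weight q 1 c else 1)"
    by (rule prod.cong) (auto simp: extend_flow_simps weight_def)
  also have "\<dots> = weight q 1 c" using j by simp
  finally show ?thesis by (simp add: mult.commute)
qed

text \<open>A flow corresponds to the receiver \<open>j\<close> of the last vertex and the remaining
  flow. For \<open>j = 0\<close> the update changes \<open>a\<close> only at the sink, where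
  \<open>flow_polytope\<close> reads no supply.\<close>

lemma sum_unit_flows_Suc:
  assumes pos: "\<forall>k\<in>{1..Suc n}. a k > 0"
  shows "(\<Sum>A\<in>unit_flows (Suc n) (upto_edges E (Suc n)) a. flow_prod (upto_edges E (Suc n)) q A) =
    (\<Sum>j\<in>top_nbrs E n. \<Sum>A\<in>unit_flows n (upto_edges E n) (a(j := a j + a (Suc n))).
       weight q 1 (a (Suc n)) * flow_prod (upto_edges E n) q A)"
proof -
  let ?N = "top_nbrs E n" and ?d = "directed_edges (upto_edges E n)"
  let ?U = "\<lambda>j. unit_flows n (upto_edges E n) (a(j := a j + a (Suc n)))"
  let ?X = "\<lambda>j A. extend_flow E n (real (a (Suc n))) j A"
  have a: "a (Suc n) > 0" using pos by auto
  have top: "{i \<in> ?N. ?X j A (Suc n, i) > 0} = {j}" if "j \<in> ?N" for j A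
    using that a by (auto simp: extend_flow_simps split: if_splits)
  have "(\<Sum>A\<in>unit_flows (Suc n) (upto_edges E (Suc n)) a. flow_prod (upto_edges E (Suc n)) q A)
    = (\<Sum>(j, A)\<in>Sigma ?N ?U. weight q 1 (a (Suc n)) * flow_prod (upto_edges E n) q A)"
  proof (rule sum.reindex_bij_witness[where i = "\<lambda>(j, A). ?X j A" and
        j = "\<lambda>X. (the_elem {i \<in> ?N. X (Suc n, i) > 0}, restrict X ?d)"])
    fix X assume "X \<in> unit_flows (Suc n) (upto_edges E (Suc n)) a"
    from unit_flow_top[OF pos this] obtain j where j: "j \<in> ?N" "{j \<in> ?N. X (Suc n, j) > 0} = {j}"
      "restrict X ?d \<in> ?U j" "X = ?X j (restrict X ?d)" by auto
    show "(case (the_elem {i \<in> ?N. X (Suc n, i) > 0}, restrict X ?d) of (j, A) \<Rightarrow> ?X j A) = X"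
      using j(2,4) by simp
    show "(the_elem {i \<in> ?N. X (Suc n, i) > 0}, restrict X ?d) \<in> Sigma ?N ?U"
      unfolding j(2) using j(1,3) by simp
    show "(case (the_elem {i \<in> ?N. X (Suc n, i) > 0}, restrict X ?d) of
       (j, A) \<Rightarrow> weight q 1 (a (Suc n)) * flow_prod (upto_edges E n) q A) = flow_prod (upto_edges E (Suc n)) q X"
      using flow_prod_extend[OF j(1), of q "a (Suc n)" "restrict X ?d"] j(4) by simp
  next
    fix p assume "p \<in> Sigma ?N ?U"
    then obtain j A where p: "p = (j, A)" "j \<in> ?N" "A \<in> ?U j" by auto
    show "(\<lambda>X. (the_elem {i \<in> ?N. X (Suc n, i) > 0}, restrict X ?d)) (case p of (j, A) \<Rightarrow> ?X j A) = p"
      unfolding p(1) prod.case extend_flow_unit(2)[OF a p(2,3)] top[OF p(2)] by simp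
    show "(case p of (j, A) \<Rightarrow> ?X j A) \<in> unit_flows (Suc n) (upto_edges E (Suc n)) a"
      using extend_flow_unit(1)[OF a p(2,3)] p(1) by simp
  qed
  also have "\<dots> = (\<Sum>j\<in>?N. \<Sum>A\<in>?U j. weight q 1 (a (Suc n)) * flow_prod (upto_edges E n) q A)"
  proof (rule sum.Sigma[symmetric])
    have "finite (?U j)" for j
      by (rule finite_subset[OF _ finite_integer_flows[of "upto_edges E n" n]]) (auto simp: unit_flows_def)
    then show "\<forall>j\<in>?N. finite (?U j)" by simp
  qed simp
  finally show ?thesis .
qed

text \<open>By \<open>weight_mult\<close> the recursion becomes \<open>conn_poly_contract\<close>
  for \<open>V = {0..n}\<close> and \<open>m = Suc n\<close>; \<open>a\<close> is arbitrary in the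
  induction because each step updates it.\<close>

lemma sum_unit_flows_conn_poly:
  fixes q :: "'a::idom_divide"
  assumes q: "q \<noteq> 1" and E: "\<forall>e\<in>E. card e = 2" and sh: "shifted E" and pos: "\<forall>k\<in>{1..n}. a k > 0"
  shows "(q - 1) ^ n * (\<Sum>A\<in>unit_flows n (upto_edges E n) a. flow_prod (upto_edges E n) q A)
    = conn_poly E (max_wt q a) {0..n}"
  using pos
proof (induction n arbitrary: a)
  case 0
  have d: "directed_edges (upto_edges E 0) = {}" by (auto simp: directed_edges_def)
  \<comment> \<open>Without edges the only extensional function is
    \<open>\<lambda>_. undefined\<close>, and it balances vertex 0.\<close>
  then have "unit_flows 0 (upto_edges E 0) a = {\<lambda>_. undefined}"
    by (auto simp: unit_flows_def integer_flows_def flow_polytope_def net_flow_def)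
  then show ?case using conn_poly_singleton[OF E, of "max_wt q a" 0] d by (simp add: flow_prod_def)
next
  case (Suc n)
  let ?F = "\<lambda>n a. \<Sum>A\<in>unit_flows n (upto_edges E n) a. flow_prod (upto_edges E n) q A"
  let ?b = "\<lambda>j. a(j := a j + a (Suc n))"
  have w: "(q - 1) * weight q 1 (a (Suc n)) = q ^ a (Suc n) - 1"
    using weight_mult[OF q, of "a (Suc n)"] Suc.prems by (simp add: mult.commute)
  have "(q - 1) ^ Suc n * ?F (Suc n) a
    = (\<Sum>j\<in>top_nbrs E n. ((q - 1) * weight q 1 (a (Suc n))) * ((q - 1) ^ n * ?F n (?b j)))"
    unfolding sum_unit_flows_Suc[OF Suc.prems] sum_distrib_left by (simp add: mult_ac)
  also have "\<dots> = (\<Sum>j\<in>top_nbrs E n. (q ^ a (Suc n) - 1) * conn_poly E (max_wt q (?b j)) {0..n})"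
  proof (rule sum.cong)
    fix j
    have "(q - 1) ^ n * ?F n (?b j) = conn_poly E (max_wt q (?b j)) {0..n}"
      by (rule Suc.IH) (use Suc.prems in auto)
    then show "((q - 1) * weight q 1 (a (Suc n))) * ((q - 1) ^ n * ?F n (?b j))
      = (q ^ a (Suc n) - 1) * conn_poly E (max_wt q (?b j)) {0..n}" unfolding w by simp
  qed simp
  also have "\<dots> = conn_poly E (max_wt q a) (insert (Suc n) {0..n})"
    by (rule conn_poly_contract[OF E sh, symmetric]) auto
  also have "insert (Suc n) {0..n} = {0..Suc n}" by auto
  finally show ?case .
qed

theorem theorem3p11:
  fixes n :: nat and E :: "nat set set" and a :: "nat \<Rightarrow> nat"
  assumes "threshold_graph {0..n} E"
    and "reverse_degree_labeled n E"
    and "\<forall>k\<in>{1..n}. a k > 0"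
  shows "(connected_graph {0..n} E \<longrightarrow>
            Ehr n E (\<lambda>k. real (a k)) q_var 1 = tutte {0..n} (parallel_edges E a) fst 1 q_var)
       \<and> Ehr n E (\<lambda>k. real (a k)) q_var 1 = (\<Sum>T\<in>spanning_trees {0..n} E. tree_weight n a q_var T)"
proof -
  let ?D = "conn_poly E (max_wt q_var a) {0..n}" and ?Ehr = "Ehr n E (\<lambda>k. real (a k)) q_var 1"
  have E: "\<forall>e\<in>E. card e = 2" "E \<subseteq> Pow {0..n}" using threshold_graph_simple[OF assms(1)] by auto
  have sh: "shifted E" using assms(1,2) by (rule threshold_graph_shifted)
  have q: "q_var \<noteq> 1" by (simp add: one_pCons)
  then have q0: "(q_var - 1) ^ n \<noteq> 0" by simp
  have "E \<inter> Pow {0..n} = E" using E by auto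
  then have Ehr: "(q_var - 1) ^ n * ?Ehr = ?D"
    using sum_unit_flows_conn_poly[OF q E(1) sh assms(3)] Ehr_unit_flows[OF E(2) assms(3), of q_var] by simp
  have "?Ehr = tutte {0..n} (parallel_edges E a) fst 1 q_var" if c: "connected_graph {0..n} E"
  proof -
    have "a (Max e) > 0" if e: "e \<in> E" for e
    proof -
      have e2: "card e = 2" "e \<subseteq> {0..n}" using e E by auto
      then have fin: "finite e" using finite_subset by blast
      \<comment> \<open>Positivity of \<open>a\<close> is known from index 1 on; the larger of two
        distinct naturals is at least 1.\<close>
      have "Max e \<noteq> 0"
      proof
        assume "Max e = 0"
        then have "e \<subseteq> {0}" using fin Max_ge[OF fin] by auto
        then have "card e \<le> card {0::nat}" by (intro card_mono) auto
        then show False using e2 by simp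
      qed
      moreover have "Max e \<in> {0..n}" using e2 fin Max_in[OF fin] by fastforce
      ultimately show ?thesis using assms(3) by auto
    qed
    then have "(q_var - 1) ^ n * tutte {0..n} (parallel_edges E a) fst 1 q_var = ?D"
      using tutte_conn_poly[OF _ _ E, of a q_var] c by simp
    then show ?thesis using Ehr q0 by (metis mult_left_cancel)
  qed
  \<comment> \<open>For a disconnected graph the sum over trees and \<open>?D\<close> are both empty
    sums.\<close>
  moreover have "(q_var - 1) ^ n * (\<Sum>T\<in>spanning_trees {0..n} E. tree_weight n a q_var T) = ?D"
    using sum_rooted_weight[OF E(1) sh, of "{0..n}" 0 q_var a] spanning_trees_eq[OF _ _ E]
    by (simp add: tree_weight_eq)
  then have "?Ehr = (\<Sum>T\<in>spanning_trees {0..n} E. tree_weight n a q_var T)"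
    using Ehr q0 by (metis mult_left_cancel)
  ultimately show ?thesis by blast
qed

end
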